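(* A rational transduction $f$ is aperiodic (i.e. $\mathcal{A}p$-rational) if and only if its canonical bimachine $\mathcal B_f$ is aperiodic, i.e. both $\mathit{Left}_f(\mathcal R_f)$ and $\mathcal R_f$ have aperiodic transition congruences.
   Context: A congruence $\sim$ on $\Sigma^*$ is aperiodic if there is $n$ with $w^n\sim w^{n+1}$ for all $w$. For an automaton $\mathcal A=(Q,\Delta,I,F)$ (left or right), $u\approx_{\mathcal A}v$ iff for all $p,q$ there is a run on $u$ from $p$ to $q$ iff on $v$; $\mathcal A$ is aperiodic if $\approx_{\mathcal A}$ is aperiodic. A transduction is $\mathcal{A}p$-rational if realized by a functional transducer (automaton with outputs on transitions, initial and final outputs) with aperiodic underlying automaton. Notation: $u^{-1}v$ is the $v'$ with $uv'=v$; $\bigwedge L$ is the longest common prefix ($\bigwedge\emptyset=\varepsilon$); $d(u,v)=|u|+|v|-2|u\wedge v|$. Define $u\leftharpoonup_fv$ iff for all $w$, $wu\in\mathrm{dom}f\Leftrightarrow wv\in\mathrm{dom}f$ and $\sup\{d(f(wu),f(wv)):wu\in\mathrm{dom}f\}<\infty$. $\mathcal R_f$ is the right automaton (backward deterministic, read right to left) with states $\Sigma^*/{\leftharpoonup_f}$, transitions $([\sigma w],\sigma,[w])$, initial $[\varepsilon]$, finals $\{[w]:w\in\mathrm{dom}f\}$; write $[w]_{\mathcal R_f}$ for the class. Let $\widehat f_{[w]}(u)=\bigwedge\{f(uv):v\leftharpoonup_fw,uv\in\mathrm{dom}f\}$ and $u\sim_Lv$ iff for all $w$, $uw\in\mathrm{dom}f\Leftrightarrow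 vw\in\mathrm{dom}f$ and (if so) $\widehat f_{[w]}(u)^{-1}f(uw)=\widehat f_{[w]}(v)^{-1}f(vw)$. $\mathit{Left}_f(\mathcal R_f)$ is the deterministic automaton on $\Sigma^*/{\sim_L}$ with transitions $([u],\sigma,[u\sigma])$, initial $[\varepsilon]$, finals $\{[u]:u\in\mathrm{dom}f\}$. The canonical bimachine is $\mathcal B_f=(\mathit{Left}_f(\mathcal R_f),\mathcal R_f,\omega_f,\lambda_f,\rho_f)$ with $\omega_f([u]_L,\sigma,[w])=\widehat f_{[\sigma w]}(u)^{-1}\widehat f_{[w]}(u\sigma)$, $\lambda_f([w])=\widehat f_{[w]}(\varepsilon)$, $\rho_f([u]_L)=\widehat f_{[\varepsilon]}(u)^{-1}f(u)$; it realizes $f$. *)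

theory Defs
  imports Main "HOL-Library.Sublist"
begin

definition lcp_set :: "'b list set \<Rightarrow> 'b list" where
  "lcp_set L = (if L = {} then []
     else (THE p. (\<forall>x\<in>L. prefix p x) \<and> (\<forall>q. (\<forall>x\<in>L. prefix q x) \<longrightarrow> prefix q p)))"

definition lquot :: "'b list \<Rightarrow> 'b list \<Rightarrow> 'b list" where
  "lquot u v = drop (length u) v"   \<comment> \<open>u^{-1} v, used only when u is a prefix of v\<close>

definition wdist :: "'b list \<Rightarrow> 'b list \<Rightarrow> nat" where
  "wdist u v = length u + length v - 2 * length (lcp_set {u, v})"

definition wpow :: "'a list \<Rightarrow> nat \<Rightarrow> 'a list" where
  "wpow w n = concat (replicate n w)"

fun runs :: "('s \<times> 'a \<times> 's) set \<Rightarrow> 's \<Rightarrow> 'a list \<Rightarrow> 's \<Rightarrow> bool" where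
  "runs \<Delta> p [] q = (p = q)"
| "runs \<Delta> p (a # u) q = (\<exists>p'. (p, a, p') \<in> \<Delta> \<and> runs \<Delta> p' u q)"

definition trans_cong :: "('s \<times> 'a \<times> 's) set \<Rightarrow> 'a list \<Rightarrow> 'a list \<Rightarrow> bool" where
  "trans_cong \<Delta> u v = (\<forall>p q. runs \<Delta> p u q \<longleftrightarrow> runs \<Delta> p v q)"

definition aperiodic_cong :: "('a list \<Rightarrow> 'a list \<Rightarrow> bool) \<Rightarrow> bool" where
  "aperiodic_cong R = (\<exists>n. \<forall>w. R (wpow w n) (wpow w (Suc n)))"

definition aperiodic_aut :: "('s \<times> 'a \<times> 's) set \<Rightarrow> bool" where
  "aperiodic_aut \<Delta> = aperiodic_cong (trans_cong \<Delta>)"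

record ('a, 'b) transducer =
  tstates :: "nat set"
  ttrans :: "(nat \<times> 'a \<times> 'b list \<times> nat) set"
  tinit :: "nat \<Rightarrow> 'b list option"
  tfinal :: "nat \<Rightarrow> 'b list option"

fun truns :: "(nat \<times> 'a \<times> 'b list \<times> nat) set \<Rightarrow> nat \<Rightarrow> 'a list \<Rightarrow> 'b list \<Rightarrow> nat \<Rightarrow> bool" where
  "truns \<Delta> p [] x q = (p = q \<and> x = [])"
| "truns \<Delta> p (a # u) x q =
     (\<exists>y p' z. (p, a, y, p') \<in> \<Delta> \<and> truns \<Delta> p' u z q \<and> x = y @ z)"

definition wf_transducer :: "('a, 'b) transducer \<Rightarrow> bool" where
  "wf_transducer T = (finite (tstates T) \<and> finite (ttrans T)
     \<and> ttrans T \<subseteq> tstates T \<times> UNIV \<times> UNIV \<times> tstates T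
     \<and> dom (tinit T) \<subseteq> tstates T \<and> dom (tfinal T) \<subseteq> tstates T)"

text \<open>T realizes f: f u = Some v iff some accepting run on u has output v
  (this also forces T to be functional).\<close>
definition realizes :: "('a, 'b) transducer \<Rightarrow> ('a list \<Rightarrow> 'b list option) \<Rightarrow> bool" where
  "realizes T f = (\<forall>u v. f u = Some v \<longleftrightarrow>
     (\<exists>p q i x e. tinit T p = Some i \<and> truns (ttrans T) p u x q \<and> tfinal T q = Some e
                 \<and> v = i @ x @ e))"

definition underlying :: "('a, 'b) transducer \<Rightarrow> (nat \<times> 'a \<times> nat) set" where
  "underlying T = {(p, a, q). \<exists>x. (p, a, x, q) \<in> ttrans T}"

definition rational :: "('a list \<Rightarrow> 'b list option) \<Rightarrow> bool" where
  "rational f = (\<exists>T. wf_transducer T \<and> realizes T f)"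

definition Ap_rational :: "('a list \<Rightarrow> 'b list option) \<Rightarrow> bool" where
  "Ap_rational f = (\<exists>T. wf_transducer T \<and> realizes T f \<and> aperiodic_aut (underlying T))"

definition rel_R :: "('a list \<Rightarrow> 'b list option) \<Rightarrow> 'a list \<Rightarrow> 'a list \<Rightarrow> bool" where
  "rel_R f u v = ((\<forall>w. w @ u \<in> dom f \<longleftrightarrow> w @ v \<in> dom f)
     \<and> bdd_above {wdist (the (f (w @ u))) (the (f (w @ v))) | w. w @ u \<in> dom f})"

definition class_R :: "('a list \<Rightarrow> 'b list option) \<Rightarrow> 'a list \<Rightarrow> 'a list set" where
  "class_R f w = {v. rel_R f v w}"

definition trans_R :: "('a list \<Rightarrow> 'b list option) \<Rightarrow> ('a list set \<times> 'a \<times> 'a list set) set" where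
  "trans_R f = {(class_R f (s # w), s, class_R f w) | s w. True}"

definition fhat :: "('a list \<Rightarrow> 'b list option) \<Rightarrow> 'a list \<Rightarrow> 'a list \<Rightarrow> 'b list" where
  "fhat f w u = lcp_set {the (f (u @ v)) | v. rel_R f v w \<and> u @ v \<in> dom f}"

definition rel_L :: "('a list \<Rightarrow> 'b list option) \<Rightarrow> 'a list \<Rightarrow> 'a list \<Rightarrow> bool" where
  "rel_L f u v = (\<forall>w. (u @ w \<in> dom f \<longleftrightarrow> v @ w \<in> dom f)
     \<and> (u @ w \<in> dom f \<longrightarrow>
          lquot (fhat f w u) (the (f (u @ w))) = lquot (fhat f w v) (the (f (v @ w)))))"

definition class_L :: "('a list \<Rightarrow> 'b list option) \<Rightarrow> 'a list \<Rightarrow> 'a list set" where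
  "class_L f u = {v. rel_L f v u}"

definition trans_Left :: "('a list \<Rightarrow> 'b list option) \<Rightarrow> ('a list set \<times> 'a \<times> 'a list set) set" where
  "trans_Left f = {(class_L f u, s, class_L f (u @ [s])) | u s. True}"

definition canonical_bimachine_aperiodic :: "('a list \<Rightarrow> 'b list option) \<Rightarrow> bool" where
  "canonical_bimachine_aperiodic f = (aperiodic_aut (trans_Left f) \<and> aperiodic_aut (trans_R f))"

end

theory Submission
  imports Defs
begin

text \<open>
  If an aperiodic transducer realizes \<open>f\<close>, then \<open>w\<^sup>n\<close> and \<open>w\<^sup>n\<^sup>+\<^sup>1\<close> lead to final states from the same
  states, so they are identified by the right congruence. For the left congruence, a run on a large
  power of \<open>w\<close> visits some state twice; by aperiodicity this state has a loop on every
  \<open>w\<^sup>K\<close> with \<open>K\<close> large, and functionality forces the loop outputs to be \<open>x \<gamma>\<^sup>j\<close>. Hence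
  \<open>f (u w\<^sup>N\<^sup>+\<^sup>j v) = A\<^sub>v C\<^sub>v\<^sup>j t\<^sub>v\<close>. As \<open>v\<close> ranges over one right class these words stay at bounded distance,
  so the \<open>A\<^sub>v C\<^sub>v\<^sup>j\<close> are conjugate and the words take the form \<open>P D\<^sup>j Z\<^sub>v\<close> with \<open>P\<close>, \<open>D\<close>
  independent of \<open>v\<close>. The prefix \<open>P D\<^sup>j\<close> cancels in \<open>fhat\<^sup>-\<^sup>1 f\<close>, which therefore does not depend on \<open>j\<close>.

  Conversely the canonical bimachine of a rational function is finite, because a reached output and
  \<open>fhat\<close> differ by a bounded delay; its two automata run in parallel form a transducer for \<open>f\<close>
  whose transition congruence is the intersection of the two given ones.
\<close>

section \<open>Words and runs\<close>

lemma lcp_set_conv: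
  assumes "L \<noteq> {}"
  shows "lcp_set L = Longest_common_prefix L"
proof -
  have "(THE p. (\<forall>x\<in>L. prefix p x) \<and> (\<forall>q. (\<forall>x\<in>L. prefix q x) \<longrightarrow> prefix q p))
      = Longest_common_prefix L"
  proof (rule the_equality)
    show "(\<forall>x\<in>L. prefix (Longest_common_prefix L) x) \<and>
        (\<forall>q. (\<forall>x\<in>L. prefix q x) \<longrightarrow> prefix q (Longest_common_prefix L))"
      using assms by (auto intro: Longest_common_prefix_prefix Longest_common_prefix_max_prefix)
  next
    fix p assume "(\<forall>x\<in>L. prefix p x) \<and> (\<forall>q. (\<forall>x\<in>L. prefix q x) \<longrightarrow> prefix q p)"
    then show "p = Longest_common_prefix L"
      using assms by (meson Longest_common_prefix_max_prefix Longest_common_prefix_prefix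
        prefix_order.antisym)
  qed
  then show ?thesis using assms by (simp add: lcp_set_def)
qed

lemma lcp_set_prefix: "x \<in> L \<Longrightarrow> prefix (lcp_set L) x"
  by (metis Longest_common_prefix_prefix empty_iff lcp_set_conv)

lemma lcp_set_greatest: "L \<noteq> {} \<Longrightarrow> (\<And>x. x \<in> L \<Longrightarrow> prefix q x) \<Longrightarrow> prefix q (lcp_set L)"
  by (simp add: lcp_set_conv Longest_common_prefix_max_prefix)

lemma lcp_set_append:
  assumes "L \<noteq> {}"
  shows "lcp_set ((@) p ` L) = p @ lcp_set L"
proof (rule prefix_order.antisym)
  have "prefix p (lcp_set ((@) p ` L))"
    using assms by (intro lcp_set_greatest) auto
  then obtain r where r: "lcp_set ((@) p ` L) = p @ r" by (auto simp: prefix_def)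
  have "prefix r (lcp_set L)"
  proof (rule lcp_set_greatest[OF assms])
    fix x assume "x \<in> L"
    then have "prefix (lcp_set ((@) p ` L)) (p @ x)" by (intro lcp_set_prefix) auto
    then show "prefix r x" using r by simp
  qed
  then show "prefix (lcp_set ((@) p ` L)) (p @ lcp_set L)" using r by simp
next
  show "prefix (p @ lcp_set L) (lcp_set ((@) p ` L))"
    using assms by (intro lcp_set_greatest) (auto intro: lcp_set_prefix)
qed

lemma lquot_append [simp]: "lquot (p @ x) (p @ y) = lquot x y"
  by (simp add: lquot_def)

lemma lquot_Nil [simp]: "lquot u [] = []"
  by (simp add: lquot_def)

lemma append_lquot: "prefix u v \<Longrightarrow> u @ lquot u v = v"
  by (auto simp: lquot_def prefix_def)

section \<open>The prefix distance\<close>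

lemma length_lcp_set_pair:
  "length (lcp_set {u, v}) \<le> length u" "length (lcp_set {u, v}) \<le> length v"
  by (auto intro!: prefix_length_le lcp_set_prefix)

lemma length_prefix_le_lcp_set_pair:
  "prefix p u \<Longrightarrow> prefix p v \<Longrightarrow> length p \<le> length (lcp_set {u, v})"
  by (auto intro!: prefix_length_le lcp_set_greatest)

lemma wdist_add: "wdist u v + 2 * length (lcp_set {u, v}) = length u + length v"
  using length_lcp_set_pair[of u v] by (simp add: wdist_def)

lemma wdist_refl [simp]: "wdist u u = 0"
  using length_prefix_le_lcp_set_pair[of u u u] by (simp add: wdist_def)

lemma wdist_commute: "wdist u v = wdist v u"
  by (simp add: wdist_def insert_commute add.commute)

text \<open>Both \<open>?a\<close> and \<open>?b\<close> are prefixes of \<open>v\<close>, hence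
  comparable, and the shorter one is a common prefix of \<open>u\<close> and
  \<open>w\<close>.\<close>

lemma wdist_triangle: "wdist u w \<le> wdist u v + wdist v w"
proof -
  let ?a = "lcp_set {u, v}" and ?b = "lcp_set {v, w}" and ?c = "lcp_set {u, w}"
  have p: "prefix ?a u" "prefix ?a v" "prefix ?b v" "prefix ?b w"
    by (auto intro: lcp_set_prefix)
  then have "prefix ?a ?b \<or> prefix ?b ?a" using prefix_same_cases by blast
  then have "min (length ?a) (length ?b) \<le> length ?c"
    using p by (metis length_prefix_le_lcp_set_pair min.coboundedI1 min.coboundedI2 prefix_order.trans)
  moreover have "length ?a \<le> length v" "length ?b \<le> length v"
    using p prefix_length_le by auto
  ultimately show ?thesis
    using wdist_add[of u v] wdist_add[of v w] wdist_add[of u w] by linarith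
qed

lemma wdist_append_le: "wdist (x @ y) (x @ z) \<le> length y + length z"
  using wdist_add[of "x @ y" "x @ z"] length_prefix_le_lcp_set_pair[of x "x @ y" "x @ z"] by simp

lemma length_le_wdist: "length u \<le> length (lcp_set {u, v}) + wdist u v"
  using wdist_add[of u v] length_lcp_set_pair[of u v] by linarith

section \<open>Powers of words, runs and aperiodicity\<close>

lemma wpow_0 [simp]: "wpow w 0 = []"
  by (simp add: wpow_def)

lemma wpow_Suc [simp]: "wpow w (Suc n) = w @ wpow w n"
  by (simp add: wpow_def)

lemma wpow_add: "wpow w (m + n) = wpow w m @ wpow w n"
  by (simp add: wpow_def replicate_add)

lemma wpow_Suc_right: "wpow w (Suc n) = wpow w n @ w"
  using wpow_add[of w n 1] by simp

lemma wpow_Nil [simp]: "wpow [] n = []"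
  by (induction n) auto

lemma length_wpow [simp]: "length (wpow w n) = n * length w"
  by (induction n) auto

lemma runs_append: "runs \<Delta> p (u @ v) q \<longleftrightarrow> (\<exists>r. runs \<Delta> p u r \<and> runs \<Delta> r v q)"
  by (induction u arbitrary: p) auto

lemma trans_cong_append_left:
  "trans_cong \<Delta> u v \<Longrightarrow> trans_cong \<Delta> (x @ u) (x @ v)"
  by (auto simp: trans_cong_def runs_append)

text \<open>Prepending \<open>wpow w (m - n)\<close> moves the one-step law from exponent
  \<open>n\<close> to any larger \<open>m\<close>; chaining these steps identifies all large
  powers.\<close>

lemma aperiodic_autE:
  assumes "aperiodic_aut \<Delta>"
  obtains n where "\<And>m w. n \<le> m \<Longrightarrow> trans_cong \<Delta> (wpow w m) (wpow w n)"
proof -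
  obtain n where n: "\<And>w. trans_cong \<Delta> (wpow w n) (wpow w (Suc n))"
    using assms by (auto simp: aperiodic_aut_def aperiodic_cong_def)
  have "trans_cong \<Delta> (wpow w m) (wpow w n)" if "n \<le> m" for m w
    using that
  proof (induction m rule: dec_induct)
    case (step m)
    have "trans_cong \<Delta> (wpow w (Suc m)) (wpow w m)"
      using trans_cong_append_left[OF n, of "wpow w (m - n)" w] step.hyps
      by (metis add_Suc_right diff_add_inverse2 le_add_diff_inverse2 trans_cong_def wpow_add)
    then show ?case using step.IH by (auto simp: trans_cong_def)
  qed (simp add: trans_cong_def)
  then show thesis using that by blast
qed

text \<open>Serves to count classes: \<open>h\<close> sends a word to its class and \<open>g\<close>
  is an invariant with finitely many values that determines the class.\<close>

lemma finite_range_factor: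
  assumes "finite (range g)" and "\<And>x y. g x = g y \<Longrightarrow> h x = h y"
  shows "finite (range h)"
proof -
  have "h x = h (SOME y. g y = g x)" for x
    by (rule assms(2)) (metis (mono_tags, lifting) someI)
  then have "range h \<subseteq> (\<lambda>s. h (SOME y. g y = s)) ` range g" by blast
  then show ?thesis using assms(1) finite_surj by blast
qed

section \<open>The congruences of the canonical bimachine\<close>

lemma rel_R_refl [simp]: "rel_R f u u"
  by (auto simp: rel_R_def bdd_above_def)

lemma rel_R_dom_iff: "rel_R f u v \<Longrightarrow> w @ u \<in> dom f \<longleftrightarrow> w @ v \<in> dom f"
  unfolding rel_R_def by blast

lemma rel_R_wdist_bounded:
  assumes "rel_R f u v"
  shows "\<exists>K. \<forall>w. w @ u \<in> dom f \<longrightarrow> wdist (the (f (w @ u))) (the (f (w @ v))) \<le> K"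
proof -
  have "bdd_above {wdist (the (f (w @ u))) (the (f (w @ v))) | w. w @ u \<in> dom f}"
    by (rule conjunct2[OF assms[unfolded rel_R_def]])
  then obtain K where "\<forall>x\<in>{wdist (the (f (w @ u))) (the (f (w @ v))) | w. w @ u \<in> dom f}. x \<le> K"
    unfolding bdd_above_def by (rule exE)
  then have "\<forall>w. w @ u \<in> dom f \<longrightarrow> wdist (the (f (w @ u))) (the (f (w @ v))) \<le> K"
    by auto
  then show ?thesis ..
qed

lemma rel_RI:
  assumes "\<And>w. w @ u \<in> dom f \<longleftrightarrow> w @ v \<in> dom f"
    and "\<And>w. w @ u \<in> dom f \<Longrightarrow> wdist (the (f (w @ u))) (the (f (w @ v))) \<le> K"
  shows "rel_R f u v"
  unfolding rel_R_def using assms by (intro conjI allI bdd_aboveI[of _ K]) auto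

lemma rel_R_sym:
  assumes "rel_R f u v"
  shows "rel_R f v u"
proof -
  obtain K where "\<And>w. w @ u \<in> dom f \<Longrightarrow> wdist (the (f (w @ u))) (the (f (w @ v))) \<le> K"
    using rel_R_wdist_bounded[OF assms] by blast
  then have "wdist (the (f (w @ v))) (the (f (w @ u))) \<le> K" if "w @ v \<in> dom f" for w
    using that rel_R_dom_iff[OF assms, of w] wdist_commute by metis
  then show ?thesis
    by (intro rel_RI rel_R_dom_iff[OF assms, symmetric])
qed

lemma rel_R_trans:
  assumes "rel_R f u v" "rel_R f v w"
  shows "rel_R f u w"
proof -
  obtain K where K: "\<And>x. x @ u \<in> dom f \<Longrightarrow> wdist (the (f (x @ u))) (the (f (x @ v))) \<le> K"
    using rel_R_wdist_bounded[OF assms(1)] by blast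
  obtain K' where K': "\<And>x. x @ v \<in> dom f \<Longrightarrow> wdist (the (f (x @ v))) (the (f (x @ w))) \<le> K'"
    using rel_R_wdist_bounded[OF assms(2)] by blast
  show ?thesis
  proof (rule rel_RI[of _ _ _ "K + K'"])
    fix x
    show "x @ u \<in> dom f \<longleftrightarrow> x @ w \<in> dom f"
      using rel_R_dom_iff[OF assms(1)] rel_R_dom_iff[OF assms(2)] by (rule trans)
    assume "x @ u \<in> dom f"
    then show "wdist (the (f (x @ u))) (the (f (x @ w))) \<le> K + K'"
      using K K' rel_R_dom_iff[OF assms(1)] by (blast intro: order.trans[OF wdist_triangle add_mono])
  qed
qed

lemma rel_R_append:
  assumes "rel_R f u v"
  shows "rel_R f (x @ u) (x @ v)"
proof -
  obtain K where "\<And>w. w @ u \<in> dom f \<Longrightarrow> wdist (the (f (w @ u))) (the (f (w @ v))) \<le> K"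
    using rel_R_wdist_bounded[OF assms] by blast
  from rel_RI[of "x @ u" f "x @ v", OF _ this[of "_ @ x", unfolded append.assoc]]
  show ?thesis
    using rel_R_dom_iff[OF assms, of "_ @ x", unfolded append.assoc] by blast
qed

lemma class_R_eq_iff: "class_R f u = class_R f v \<longleftrightarrow> rel_R f u v"
  unfolding class_R_def using rel_R_refl rel_R_sym rel_R_trans by blast

lemma fhat_cong:
  assumes "rel_R f w w'"
  shows "fhat f w = fhat f w'"
proof -
  have "rel_R f v w \<longleftrightarrow> rel_R f v w'" for v
    using assms rel_R_sym rel_R_trans by blast
  then show ?thesis by (simp add: fhat_def fun_eq_iff)
qed

lemma prefix_fhat: "rel_R f v w \<Longrightarrow> u @ v \<in> dom f \<Longrightarrow> prefix (fhat f w u) (the (f (u @ v)))"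
  unfolding fhat_def by (rule lcp_set_prefix) blast

text \<open>If \<open>v\<close> is related to \<open>w\<close> then \<open>x @ v\<close> is related
  to \<open>x @ w\<close>, so the right-hand side is an lcp over a smaller set. The domain
  assumption keeps that set nonempty.\<close>

lemma prefix_fhat_fhat:
  assumes "u @ x @ w \<in> dom f"
  shows "prefix (fhat f (x @ w) u) (fhat f w (u @ x))"
  unfolding fhat_def[of f w]
proof (rule lcp_set_greatest)
  show "{the (f ((u @ x) @ v)) |v. rel_R f v w \<and> (u @ x) @ v \<in> dom f} \<noteq> {}"
    using assms by (auto intro: exI[of _ w])
qed (auto intro: prefix_fhat rel_R_append)

text \<open>Expresses a transition output of the bimachine (\<open>x\<close> a letter) by the
  remainders that \<open>rel_L\<close> compares. The prefix is written with \<open>x @ v\<close>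
  instead of the equivalent \<open>x @ w\<close> to fit the contexts in
  \<open>rel_L\<close>.\<close>

lemma lquot_fhat:
  "lquot (fhat f (x @ w) u) (fhat f w (u @ x)) =
     lcp_set {lquot (fhat f (x @ v) u) (the (f (u @ x @ v))) | v. rel_R f v w \<and> u @ x @ v \<in> dom f}"
proof (cases "\<exists>v. rel_R f v w \<and> u @ x @ v \<in> dom f")
  \<comment> \<open>Both sides fall back to \<open>[]\<close> here: the lcp of the empty set is
    \<open>[]\<close>, and so is any quotient of \<open>[]\<close>.\<close>
  case False
  then have "{v. rel_R f v w \<and> (u @ x) @ v \<in> dom f} = {}"
    "{v. rel_R f v w \<and> u @ x @ v \<in> dom f} = {}" by auto
  then show ?thesis by (simp add: fhat_def[of f w] lcp_set_def)
next
  case True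
  let ?p = "fhat f (x @ w) u"
  let ?Z = "{lquot (fhat f (x @ v) u) (the (f (u @ x @ v))) | v. rel_R f v w \<and> u @ x @ v \<in> dom f}"
  let ?V = "{v. rel_R f v w \<and> u @ x @ v \<in> dom f}"
  have Z: "?Z = (\<lambda>v. lquot (fhat f (x @ v) u) (the (f (u @ x @ v)))) ` ?V"
    by blast
  have "?p @ lquot (fhat f (x @ v) u) (the (f (u @ x @ v))) = the (f (u @ x @ v))"
    if "v \<in> ?V" for v
    using that fhat_cong[OF rel_R_append, of f v w x]
    by (simp add: append_lquot prefix_fhat rel_R_append)
  then have "(@) ?p ` ?Z = (\<lambda>v. the (f (u @ x @ v))) ` ?V"
    unfolding Z image_image by (rule image_cong[OF refl])
  also have "\<dots> = {the (f ((u @ x) @ v)) |v. rel_R f v w \<and> (u @ x) @ v \<in> dom f}"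
    by auto
  finally have "fhat f w (u @ x) = lcp_set ((@) ?p ` ?Z)"
    by (simp only: fhat_def[of f w])
  then have "fhat f w (u @ x) = ?p @ lcp_set ?Z"
    using True by (subst (asm) lcp_set_append) blast+
  then show ?thesis by (simp add: lquot_def)
qed

section \<open>The left congruence\<close>

lemma rel_L_refl [simp]: "rel_L f u u"
  by (simp add: rel_L_def)

lemma rel_L_sym: "rel_L f u v \<Longrightarrow> rel_L f v u"
  by (simp add: rel_L_def)

lemma rel_L_trans: "rel_L f u v \<Longrightarrow> rel_L f v w \<Longrightarrow> rel_L f u w"
  by (simp add: rel_L_def)

lemma class_L_eq_iff: "class_L f u = class_L f v \<longleftrightarrow> rel_L f u v"
  unfolding class_L_def using rel_L_refl rel_L_sym rel_L_trans by blast

lemma rel_L_dom_iff: "rel_L f u v \<Longrightarrow> u @ w \<in> dom f \<longleftrightarrow> v @ w \<in> dom f"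
  unfolding rel_L_def by blast

lemma rel_L_lquot:
  "rel_L f u v \<Longrightarrow> u @ w \<in> dom f \<Longrightarrow>
     lquot (fhat f w u) (the (f (u @ w))) = lquot (fhat f w v) (the (f (v @ w)))"
  by (simp only: rel_L_def)

text \<open>By \<open>lquot_fhat\<close> both sides are lcps of sets of remainders, which
  \<open>rel_L\<close> makes equal. This is the well-definedness of the transition output in its
  left argument.\<close>

lemma rel_L_lquot_fhat:
  assumes "rel_L f u u'"
  shows "lquot (fhat f (x @ w) u) (fhat f w (u @ x)) = lquot (fhat f (x @ w) u') (fhat f w (u' @ x))"
proof -
  have "(z = lquot (fhat f (x @ v) u) (the (f (u @ x @ v))) \<and> rel_R f v w \<and> u @ x @ v \<in> dom f) \<longleftrightarrow>
    (z = lquot (fhat f (x @ v) u') (the (f (u' @ x @ v))) \<and> rel_R f v w \<and> u' @ x @ v \<in> dom f)"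
    for z v
  proof (cases "u @ x @ v \<in> dom f")
    case True
    show ?thesis
      unfolding rel_L_lquot[OF assms True] using True rel_L_dom_iff[OF assms, of "x @ v"] by blast
  qed (use rel_L_dom_iff[OF assms, of "x @ v"] in blast)
  then show ?thesis unfolding lquot_fhat by presburger
qed

lemma rel_L_append:
  assumes "rel_L f u u'"
  shows "rel_L f (u @ x) (u' @ x)"
  unfolding rel_L_def append.assoc
proof (intro allI conjI impI)
  fix w
  show dom: "u @ x @ w \<in> dom f \<longleftrightarrow> u' @ x @ w \<in> dom f"
    by (rule rel_L_dom_iff[OF assms])
  assume *: "u @ x @ w \<in> dom f"
  \<comment> \<open>The remainder after \<open>y @ x\<close> arises from the remainder after
    \<open>y\<close> by deleting a factor that \<open>rel_L_lquot_fhat\<close> shows to be equal for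
    \<open>u\<close> and \<open>u'\<close>.\<close>
  have split: "lquot (fhat f w (y @ x)) (the (f (y @ x @ w))) =
      lquot (lquot (fhat f (x @ w) y) (fhat f w (y @ x))) (lquot (fhat f (x @ w) y) (the (f (y @ x @ w))))"
    if "y @ x @ w \<in> dom f" for y
    by (subst (1) append_lquot[OF prefix_fhat_fhat[OF that], symmetric],
        subst (1) append_lquot[OF prefix_fhat[OF rel_R_refl that], symmetric])
      (rule lquot_append)
  show "lquot (fhat f w (u @ x)) (the (f (u @ x @ w))) =
      lquot (fhat f w (u' @ x)) (the (f (u' @ x @ w)))"
    unfolding split[OF *] split[OF *[unfolded dom]]
      rel_L_lquot_fhat[OF assms] rel_L_lquot[OF assms *] ..
qed

section \<open>Runs of the two canonical automata\<close>

lemma mem_trans_R: "(p, a, q) \<in> trans_R f \<longleftrightarrow> (\<exists>w. p = class_R f (a # w) \<and> q = class_R f w)"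
  by (auto simp: trans_R_def)

lemma mem_trans_Left:
  "(p, a, q) \<in> trans_Left f \<longleftrightarrow> (\<exists>u. p = class_L f u \<and> q = class_L f (u @ [a]))"
  by (auto simp: trans_Left_def)

text \<open>Left extension respects the classes, so the representatives chosen along a run can be
  aligned to one word \<open>w\<close>. The empty word is excluded because its run also links states
  that are no classes.\<close>

lemma runs_trans_R:
  "u \<noteq> [] \<Longrightarrow> runs (trans_R f) p u q \<longleftrightarrow> (\<exists>w. p = class_R f (u @ w) \<and> q = class_R f w)"
proof (induction u arbitrary: p)
  case (Cons a u)
  show ?case
  proof (cases "u = []")
    case False
    show ?thesis
    proof
      assume "runs (trans_R f) p (a # u) q"
      then obtain v w where *: "p = class_R f (a # v)" "class_R f v = class_R f (u @ w)"
        "q = class_R f w"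
        using Cons.IH[OF False] by (auto simp: mem_trans_R)
      then have "p = class_R f (a # u @ w)"
        using rel_R_append[of f v "u @ w" "[a]"] by (simp add: class_R_eq_iff)
      with * show "\<exists>w. p = class_R f ((a # u) @ w) \<and> q = class_R f w" by auto
    next
      assume "\<exists>w. p = class_R f ((a # u) @ w) \<and> q = class_R f w"
      then show "runs (trans_R f) p (a # u) q"
        using Cons.IH[OF False] by (auto simp: mem_trans_R)
    qed
  qed (simp add: mem_trans_R)
qed simp

lemma runs_trans_Left:
  "u \<noteq> [] \<Longrightarrow> runs (trans_Left f) p u q \<longleftrightarrow> (\<exists>x. p = class_L f x \<and> q = class_L f (x @ u))"
proof (induction u arbitrary: p)
  case (Cons a u)
  show ?case
  proof (cases "u = []")
    case False
    show ?thesis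
    proof
      assume "runs (trans_Left f) p (a # u) q"
      then obtain x y where *: "p = class_L f x" "class_L f y = class_L f (x @ [a])"
        "q = class_L f (y @ u)"
        using Cons.IH[OF False] by (auto simp: mem_trans_Left)
      then have "q = class_L f (x @ a # u)"
        using rel_L_append[of f y "x @ [a]" u] by (simp add: class_L_eq_iff)
      with * show "\<exists>x. p = class_L f x \<and> q = class_L f (x @ a # u)" by auto
    next
      assume "\<exists>x. p = class_L f x \<and> q = class_L f (x @ a # u)"
      then obtain x where "p = class_L f x" "q = class_L f ((x @ [a]) @ u)" by auto
      then show "runs (trans_Left f) p (a # u) q"
        unfolding runs.simps Cons.IH[OF False] mem_trans_Left by blast
    qed
  qed (simp add: mem_trans_Left)
qed simp

text \<open>The exponent \<open>Suc n\<close> makes the powers of a nonempty \<open>w\<close>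
  nonempty, as \<open>runs_trans_R\<close> requires; for empty \<open>w\<close> all powers
  coincide.\<close>

lemma aperiodic_trans_R:
  assumes "\<And>w x. rel_R f (wpow w (Suc n) @ x) (wpow w (Suc (Suc n)) @ x)"
  shows "aperiodic_aut (trans_R f)"
proof -
  have "trans_cong (trans_R f) (wpow w (Suc n)) (wpow w (Suc (Suc n)))" for w
  proof (cases "w = []")
    case False
    then show ?thesis
      using assms[of w] unfolding trans_cong_def class_R_eq_iff[symmetric]
      by (simp add: runs_trans_R)
  qed (simp add: trans_cong_def)
  then show ?thesis unfolding aperiodic_aut_def aperiodic_cong_def by blast
qed

lemma aperiodic_trans_Left:
  assumes "\<And>w x. rel_L f (x @ wpow w (Suc n)) (x @ wpow w (Suc (Suc n)))"
  shows "aperiodic_aut (trans_Left f)"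
proof -
  have "trans_cong (trans_Left f) (wpow w (Suc n)) (wpow w (Suc (Suc n)))" for w
  proof (cases "w = []")
    case False
    then show ?thesis
      using assms[of _ w] unfolding trans_cong_def class_L_eq_iff[symmetric]
      by (simp add: runs_trans_Left)
  qed (simp add: trans_cong_def)
  then show ?thesis unfolding aperiodic_aut_def aperiodic_cong_def by blast
qed

section \<open>Words of bounded distance\<close>

lemma prefix_wpow: "m \<le> n \<Longrightarrow> prefix (wpow w m) (wpow w n)"
  by (metis le_add_diff_inverse prefixI wpow_add)

text \<open>With different loop lengths the words would drift apart in length. Otherwise, at a large
  exponent, bounded distance forces \<open>A' @ C'\<close> into the common prefix; then
  \<open>C @ g\<close> and \<open>g @ C'\<close> are prefixes of equal length of one power of
  \<open>C\<close>.\<close>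

lemma bounded_wdist_conjugate:
  assumes bd: "\<And>j. wdist (A @ wpow C j @ t) (A' @ wpow C' j @ t') \<le> K"
  shows "length C = length C'"
    and "C \<noteq> [] \<Longrightarrow> length A \<le> length A' \<Longrightarrow> \<exists>g. A' = A @ g \<and> C @ g = g @ C'"
proof -
  show eq: "length C = length C'"
  proof (rule ccontr)
    assume ne: "length C \<noteq> length C'"
    define M where "M = K + length A + length A' + length t + length t'"
    let ?j = "Suc M"
    let ?W = "A @ wpow C ?j @ t" and ?W' = "A' @ wpow C' ?j @ t'"
    have le: "length ?W \<le> length ?W' + K" "length ?W' \<le> length ?W + K"
      using bd[of ?j] wdist_add[of ?W ?W'] length_lcp_set_pair[of ?W ?W'] by linarith+
    have "?j * length C + ?j \<le> ?j * length C' \<or> ?j * length C' + ?j \<le> ?j * length C"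
      using ne by (metis Suc_leI add.commute linorder_neqE_nat mult_Suc_right mult_le_mono2)
    then show False using le unfolding M_def by auto
  qed
  assume ne: "C \<noteq> []" and A: "length A \<le> length A'"
  \<comment> \<open>As \<open>C\<close> is nonempty, \<open>wpow C (Suc M)\<close> has at least
    \<open>Suc M\<close> letters: enough for \<open>A' @ C'\<close> to survive the loss of
    \<open>K\<close> letters at the end and to fit inside \<open>A @ wpow C (Suc M)\<close>.\<close>
  define M where "M = K + length A + length A' + length C"
  let ?W = "A @ wpow C (Suc M) @ t" and ?W' = "A' @ wpow C' (Suc M) @ t'"
  let ?p = "lcp_set {?W, ?W'}"
  have C: "1 \<le> length C" using ne by (cases C) auto
  have len: "Suc M \<le> Suc M * length C"
    using C by (metis mult.right_neutral mult_le_mono2)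
  have le: "length (A' @ C') \<le> length ?p"
  proof -
    have "length ?W' \<le> length ?p + K"
      using length_le_wdist[of ?W' ?W] bd[of "Suc M"] by (simp add: wdist_commute insert_commute)
    then show ?thesis using len eq unfolding M_def by simp
  qed
  have "prefix (A' @ C') ?W'" by simp
  then have "prefix (A' @ C') ?W"
    by (metis insertI1 insertI2 lcp_set_prefix le prefix_length_prefix prefix_order.trans)
  moreover have "prefix (A @ wpow C (Suc M)) ?W" by simp
  moreover have "length (A' @ C') \<le> length (A @ wpow C (Suc M))"
    using len eq unfolding M_def by simp
  ultimately have pre: "prefix (A' @ C') (A @ wpow C (Suc M))"
    using prefix_length_prefix by blast
  have "prefix A (A @ wpow C (Suc M))" by simp
  then have "prefix A A'"
    using pre A by (meson append_prefixD prefix_length_prefix)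
  then obtain g where g: "A' = A @ g" by (auto simp: prefix_def)
  have 1: "prefix (g @ C') (wpow C (Suc M))" using pre g by simp
  then have "prefix g (wpow C (Suc M))" by (rule append_prefixD)
  moreover have "prefix (wpow C M) (wpow C (Suc M))" by (rule prefix_wpow) simp
  moreover have "length g \<le> length (wpow C M)"
  proof -
    have "M \<le> M * length C" using C by (metis mult.right_neutral mult_le_mono2)
    moreover have "length g \<le> M" using g unfolding M_def by simp
    ultimately show ?thesis unfolding length_wpow by (rule order.trans[rotated])
  qed
  ultimately have "prefix g (wpow C M)" using prefix_length_prefix by blast
  then have "prefix (C @ g) (wpow C (Suc M))" by simp
  with 1 have "C @ g = g @ C'"
    by (metis add.commute eq length_append prefix_length_prefix prefix_order.antisym order_refl)
  with g show "\<exists>g. A' = A @ g \<and> C @ g = g @ C'" by blast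
qed

lemma wpow_conjugate: "C @ g = g @ C' \<Longrightarrow> wpow C j @ g = g @ wpow C' j"
proof (induction j)
  case (Suc j)
  have "wpow C (Suc j) @ g = (C @ g) @ wpow C' j" using Suc by simp
  also have "\<dots> = g @ wpow C' (Suc j)" using Suc.prems by simp
  finally show ?case .
qed simp

text \<open>The choice of the shortest \<open>A v\<close> as \<open>P\<close> works for all exponents at once,
  however long the other \<open>A v\<close> are; this is what makes the aperiodicity index uniform.\<close>

lemma bounded_wdist_common_form:
  fixes A C t :: "'i \<Rightarrow> 'b list"
  assumes bd: "\<And>v v'. v \<in> I \<Longrightarrow> v' \<in> I \<Longrightarrow>
      \<exists>K. \<forall>j. wdist (A v @ wpow (C v) j @ t v) (A v' @ wpow (C v') j @ t v') \<le> K"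
  shows "\<exists>P D Z. \<forall>v\<in>I. \<forall>j. A v @ wpow (C v) j @ t v = P @ wpow D j @ Z v"
proof (cases "I = {}")
  case False
  then obtain v0 where v0: "v0 \<in> I" "\<And>v. v \<in> I \<Longrightarrow> length (A v0) \<le> length (A v)"
    using ex_has_least_nat[of "\<lambda>v. v \<in> I" _ "\<lambda>v. length (A v)"] by blast
  show ?thesis
  proof (cases "C v0 = []")
    \<comment> \<open>Every \<open>C v\<close> is then empty, so the words do not vary with
      \<open>j\<close>. The \<open>A v\<close> need not extend \<open>A v0\<close> in this case, so
      \<open>P\<close> and \<open>D\<close> are empty and the whole word goes into
      \<open>Z v\<close>.\<close>
    case True
    have "C v = []" if "v \<in> I" for v
      using bd[OF v0(1) that] bounded_wdist_conjugate(1) True by (metis length_0_conv)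
    then have "\<forall>v\<in>I. \<forall>j. A v @ wpow (C v) j @ t v = [] @ wpow [] j @ (A v @ t v)"
      by simp
    then show ?thesis by (intro exI)
  next
    case False
    have "\<forall>v\<in>I. \<exists>g. A v = A v0 @ g \<and> C v0 @ g = g @ C v"
      using bd[OF v0(1)] bounded_wdist_conjugate(2)[OF _ False v0(2)] by metis
    then obtain g where g: "\<And>v. v \<in> I \<Longrightarrow> A v = A v0 @ g v \<and> C v0 @ g v = g v @ C v"
      by metis
    \<comment> \<open>The conjugating word \<open>g v\<close> passes through the power and ends up
      in \<open>Z v\<close>.\<close>
    have "\<forall>v\<in>I. \<forall>j. A v @ wpow (C v) j @ t v = A v0 @ wpow (C v0) j @ (g v @ t v)"
    proof (intro ballI allI)
      fix v j assume "v \<in> I"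
      from g[OF this] wpow_conjugate[of "C v0" "g v" "C v" j]
      show "A v @ wpow (C v) j @ t v = A v0 @ wpow (C v0) j @ (g v @ t v)"
        by (metis append.assoc)
    qed
    then show ?thesis by (intro exI)
  qed
qed simp

text \<open>\<open>\<alpha> K\<close> will be the output of the loop on \<open>w\<^sup>K\<close> at a fixed state.\<close>

lemma additive_outputs:
  fixes \<alpha> :: "nat \<Rightarrow> 'b list"
  assumes add: "\<And>K L K' L'. n \<le> K \<Longrightarrow> n \<le> L \<Longrightarrow> n \<le> K' \<Longrightarrow> n \<le> L' \<Longrightarrow> K + L = K' + L' \<Longrightarrow>
      \<alpha> K @ \<alpha> L = \<alpha> K' @ \<alpha> L'"
  shows "\<exists>\<gamma>. \<forall>j. \<alpha> (n + j) = \<alpha> n @ wpow \<gamma> j"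
proof -
  \<comment> \<open>The length is linear in \<open>j\<close> with slope
    \<open>length (\<alpha> (Suc n)) - length (\<alpha> n)\<close>; the equation is arranged to
    avoid natural subtraction.\<close>
  have len: "length (\<alpha> (n + j)) + j * length (\<alpha> n) = length (\<alpha> n) + j * length (\<alpha> (Suc n))" for j
  proof (induction j)
    case (Suc j)
    have "\<alpha> (n + Suc j) @ \<alpha> n = \<alpha> (n + j) @ \<alpha> (Suc n)" by (rule add) auto
    then have "length (\<alpha> (n + Suc j)) + length (\<alpha> n) = length (\<alpha> (n + j)) + length (\<alpha> (Suc n))"
      by (metis length_append)
    with Suc show ?case by simp
  qed simp
  \<comment> \<open>A negative slope would make the length negative at
    \<open>j = Suc (length (\<alpha> n))\<close>.\<close>
  have "length (\<alpha> n) \<le> length (\<alpha> (Suc n))"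
  proof (rule ccontr)
    assume "\<not> ?thesis"
    then have "Suc (length (\<alpha> (Suc n))) \<le> length (\<alpha> n)" by simp
    then have "Suc (length (\<alpha> n)) * Suc (length (\<alpha> (Suc n))) \<le> Suc (length (\<alpha> n)) * length (\<alpha> n)"
      by (rule mult_le_mono2)
    then show False using len[of "Suc (length (\<alpha> n))"] by simp
  qed
  moreover have comm: "\<alpha> n @ \<alpha> (Suc n) = \<alpha> (Suc n) @ \<alpha> n" by (rule add) auto
  ultimately obtain \<gamma> where \<gamma>: "\<alpha> (Suc n) = \<alpha> n @ \<gamma>"
    by (metis append_eq_append_conv_if append_take_drop_id)
  \<comment> \<open>One unit of exponent is traded between the two factors, then
    \<open>\<alpha> n\<close> is cancelled on the left.\<close>
  have step: "\<alpha> (Suc K) = \<alpha> K @ \<gamma>" if "n \<le> K" for K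
  proof -
    have "\<alpha> n @ \<alpha> (Suc K) = \<alpha> K @ \<alpha> (Suc n)" by (rule add) (use that in auto)
    also have "\<dots> = (\<alpha> K @ \<alpha> n) @ \<gamma>" by (simp add: \<gamma>)
    also have "\<alpha> K @ \<alpha> n = \<alpha> n @ \<alpha> K" by (rule add) (use that in auto)
    finally show ?thesis by simp
  qed
  have "\<alpha> (n + j) = \<alpha> n @ wpow \<gamma> j" for j
    by (induction j) (simp_all add: step wpow_Suc_right del: wpow_Suc)
  then show ?thesis by blast
qed

section \<open>Aperiodic transducers have aperiodic canonical bimachines\<close>

lemma truns_append:
  "truns \<Delta> p (u @ v) x q \<longleftrightarrow> (\<exists>y r z. truns \<Delta> p u y r \<and> truns \<Delta> r v z q \<and> x = y @ z)"
proof (induction u arbitrary: p x)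
  case (Cons a u)
  show ?case
    by (simp add: Cons.IH) (metis append.assoc)
qed simp

lemma runs_underlying: "runs (underlying T) p u q \<longleftrightarrow> (\<exists>x. truns (ttrans T) p u x q)"
  by (induction u arbitrary: p) (auto simp: underlying_def)

definition inrun :: "('a, 'b) transducer \<Rightarrow> 'a list \<Rightarrow> nat \<Rightarrow> 'b list \<Rightarrow> bool" where
  "inrun T u q y = (\<exists>p i x. tinit T p = Some i \<and> truns (ttrans T) p u x q \<and> y = i @ x)"

definition outrun :: "('a, 'b) transducer \<Rightarrow> nat \<Rightarrow> 'a list \<Rightarrow> 'b list \<Rightarrow> bool" where
  "outrun T q v z = (\<exists>q' x e. truns (ttrans T) q v x q' \<and> tfinal T q' = Some e \<and> z = x @ e)"

lemma inrun_append:
  assumes "inrun T u p y" "truns (ttrans T) p v x q"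
  shows "inrun T (u @ v) q (y @ x)"
proof -
  obtain p0 i y' where "tinit T p0 = Some i" "truns (ttrans T) p0 u y' p" "y = i @ y'"
    using assms(1) unfolding inrun_def by blast
  moreover from this have "truns (ttrans T) p0 (u @ v) (y' @ x) q"
    using assms(2) unfolding truns_append by blast
  ultimately show ?thesis unfolding inrun_def by auto
qed

lemma outrun_append:
  assumes "truns (ttrans T) p u x q" "outrun T q v z"
  shows "outrun T p (u @ v) (x @ z)"
proof -
  obtain q' y e where "truns (ttrans T) q v y q'" "tfinal T q' = Some e" "z = y @ e"
    using assms(2) unfolding outrun_def by blast
  moreover from this have "truns (ttrans T) p (u @ v) (x @ y) q'"
    using assms(1) unfolding truns_append by blast
  ultimately show ?thesis unfolding outrun_def by (metis append.assoc)
qed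

lemma outrun_appendE:
  assumes "outrun T p (u @ v) z"
  obtains x q y where "truns (ttrans T) p u x q" "outrun T q v y" "z = x @ y"
proof -
  obtain q' x q y e where "truns (ttrans T) p u x q" "truns (ttrans T) q v y q'"
    "tfinal T q' = Some e" "z = x @ y @ e"
    using assms unfolding outrun_def truns_append by auto
  then show thesis using that[of x q "y @ e"] unfolding outrun_def by blast
qed

locale transducer_for =
  fixes T :: "('a, 'b) transducer" and f :: "'a list \<Rightarrow> 'b list option"
  assumes wf: "wf_transducer T" and real: "realizes T f"
begin

text \<open>Any \<open>inrun\<close> into \<open>q\<close> may be glued to any \<open>outrun\<close>
  from \<open>q\<close>, and \<open>realizes\<close> forces all these products to be the one value
  of \<open>f\<close>.\<close>

lemma eq_Some_iff:
  "f (u @ v) = Some z \<longleftrightarrow> (\<exists>q y r. inrun T u q y \<and> outrun T q v r \<and> z = y @ r)"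
proof -
  have "f (u @ v) = Some z \<longleftrightarrow> (\<exists>p q i x e. tinit T p = Some i \<and> truns (ttrans T) p (u @ v) x q \<and>
      tfinal T q = Some e \<and> z = i @ x @ e)"
    using real by (simp add: realizes_def)
  also have "\<dots> \<longleftrightarrow> (\<exists>q y r. inrun T u q y \<and> outrun T q v r \<and> z = y @ r)"
  proof
    assume "\<exists>p q i x e. tinit T p = Some i \<and> truns (ttrans T) p (u @ v) x q \<and>
      tfinal T q = Some e \<and> z = i @ x @ e"
    then obtain p q i r y y' e where "tinit T p = Some i" "truns (ttrans T) p u y r"
      "truns (ttrans T) r v y' q" "tfinal T q = Some e" "z = (i @ y) @ (y' @ e)"
      unfolding truns_append by auto
    then show "\<exists>q y r. inrun T u q y \<and> outrun T q v r \<and> z = y @ r"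
      unfolding inrun_def outrun_def by blast
  next
    assume "\<exists>q y r. inrun T u q y \<and> outrun T q v r \<and> z = y @ r"
    then obtain p q i r y y' e where "tinit T p = Some i" "truns (ttrans T) p u y r"
      "truns (ttrans T) r v y' q" "tfinal T q = Some e" "z = i @ (y @ y') @ e"
      unfolding inrun_def outrun_def by auto
    then show "\<exists>p q i x e. tinit T p = Some i \<and> truns (ttrans T) p (u @ v) x q \<and>
      tfinal T q = Some e \<and> z = i @ x @ e"
      unfolding truns_append by blast
  qed
  finally show ?thesis .
qed

lemma in_dom_iff: "u @ v \<in> dom f \<longleftrightarrow> (\<exists>q. (\<exists>y. inrun T u q y) \<and> (\<exists>r. outrun T q v r))"
proof -
  have "u @ v \<in> dom f \<longleftrightarrow> (\<exists>z. f (u @ v) = Some z)" by auto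
  then show ?thesis unfolding eq_Some_iff by blast
qed

lemma eqI: "inrun T u q y \<Longrightarrow> outrun T q v r \<Longrightarrow> f (u @ v) = Some (y @ r)"
  using eq_Some_iff by blast

lemma finite_tstates: "finite (tstates T)"
  using wf by (simp add: wf_transducer_def)

lemma ttrans_tstates: "(p, a, x, q) \<in> ttrans T \<Longrightarrow> q \<in> tstates T"
  using wf unfolding wf_transducer_def by blast

lemma truns_tstates: "truns (ttrans T) p u x q \<Longrightarrow> p \<in> tstates T \<Longrightarrow> q \<in> tstates T"
  by (induction u arbitrary: p x) (auto dest: ttrans_tstates)

lemma inrun_tstates:
  assumes "inrun T u q y"
  shows "q \<in> tstates T"
proof -
  obtain p x where "p \<in> dom (tinit T)" "truns (ttrans T) p u x q"
    using assms unfolding inrun_def by blast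
  moreover have "dom (tinit T) \<subseteq> tstates T"
    using wf unfolding wf_transducer_def by blast
  ultimately show ?thesis using truns_tstates by blast
qed

text \<open>The values on \<open>w @ u\<close> and \<open>w @ v\<close> can share the
  \<open>inrun\<close> output \<open>y\<close>, so they differ only in their tails.\<close>

lemma rel_R_if_outruns:
  assumes eq: "\<And>q. q \<in> tstates T \<Longrightarrow> (\<exists>r. outrun T q u r) \<longleftrightarrow> (\<exists>r. outrun T q v r)"
  shows "rel_R f u v"
proof (rule rel_RI)
  \<comment> \<open>One tail is fixed for each word and state; summing over the finitely many states
    bounds the tails independently of \<open>w\<close>.\<close>
  define out where "out w q = (SOME r. outrun T q w r)" for w q
  have out: "outrun T q w (out w q)" if "\<exists>r. outrun T q w r" for w q
    unfolding out_def using that by (rule someI_ex)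
  fix w
  show "w @ u \<in> dom f \<longleftrightarrow> w @ v \<in> dom f"
    unfolding in_dom_iff using eq inrun_tstates by blast
  assume "w @ u \<in> dom f"
  then obtain q y where q: "inrun T w q y" "\<exists>r. outrun T q u r"
    unfolding in_dom_iff by blast
  then have Q: "q \<in> tstates T" and "\<exists>r. outrun T q v r"
    using inrun_tstates eq by blast+
  then have fu: "f (w @ u) = Some (y @ out u q)" and fv: "f (w @ v) = Some (y @ out v q)"
    using eqI[OF q(1) out] q(2) by blast+
  have "wdist (the (f (w @ u))) (the (f (w @ v))) \<le> length (out u q) + length (out v q)"
    unfolding fu fv option.sel by (rule wdist_append_le)
  also have "\<dots> \<le> (\<Sum>q\<in>tstates T. length (out u q) + length (out v q))"
    using member_le_sum[of q "tstates T" "\<lambda>q. length (out u q) + length (out v q)"] Q finite_tstates by simp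
  finally show "wdist (the (f (w @ u))) (the (f (w @ v))) \<le>
      (\<Sum>q\<in>tstates T. length (out u q) + length (out v q))" .
qed

text \<open>The set of states from which a word is accepted determines its right class.\<close>

lemma finite_class_R: "finite (range (class_R f))"
proof (rule finite_range_factor)
  show "finite (range (\<lambda>u. {q \<in> tstates T. \<exists>r. outrun T q u r}))"
    by (rule finite_subset[of _ "Pow (tstates T)"]) (auto simp: finite_tstates)
next
  fix u v
  assume "{q \<in> tstates T. \<exists>r. outrun T q u r} = {q \<in> tstates T. \<exists>r. outrun T q v r}"
  then have "rel_R f u v" by (intro rel_R_if_outruns) blast
  then show "class_R f u = class_R f v" by (simp add: class_R_eq_iff)
qed

text \<open>Pigeonhole on the states after the powers \<open>0\<close> to
  \<open>card (tstates T)\<close>. The last run starts at the first visit of \<open>r\<close>, so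
  that loops can be inserted there without removing a part of the original run.\<close>

lemma loop_in_wpow:
  assumes "p \<in> tstates T" "truns (ttrans T) p (wpow w (card (tstates T) + k)) x q"
  obtains i l r y z where "0 < l" "i + l \<le> card (tstates T)"
    "truns (ttrans T) p (wpow w i) y r" "\<exists>x. truns (ttrans T) r (wpow w l) x r"
    "truns (ttrans T) r (wpow w (card (tstates T) + k - i)) z q"
proof -
  define E where "E = {(p, q). runs (underlying T) p w q}"
  have E: "runs (underlying T) p (wpow w m) q \<longleftrightarrow> (p, q) \<in> E ^^ m" for p q m
    by (induction m arbitrary: q)
      (simp_all add: wpow_Suc_right runs_append E_def relcomp_unfold del: wpow_Suc)
  let ?m = "card (tstates T)"
  have "(p, q) \<in> E ^^ (?m + k)" using assms(2) E runs_underlying by blast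
  then obtain g where g: "g 0 = p" "g (?m + k) = q" "\<And>i. i < ?m + k \<Longrightarrow> (g i, g (Suc i)) \<in> E"
    by (auto simp: relpow_fun_conv)
  have path: "(g i, g (i + l)) \<in> E ^^ l" if "i + l \<le> ?m + k" for i l
    unfolding relpow_fun_conv using g(3) that by (intro exI[of _ "\<lambda>j. g (i + j)"]) auto
  have "g ` {..?m} \<subseteq> tstates T"
  proof
    fix s assume "s \<in> g ` {..?m}"
    then obtain i where "i \<le> ?m" "s = g i" by auto
    then have "runs (underlying T) p (wpow w i) s"
      using path[of 0 i] g(1) E by auto
    then show "s \<in> tstates T" using assms(1) truns_tstates unfolding runs_underlying by blast
  qed
  then have "\<not> inj_on g {..?m}"
    using card_inj_on_le[of g "{..?m}" "tstates T"] finite_tstates by auto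
  then obtain i k' where ik: "i < k'" "k' \<le> ?m" "g i = g k'"
    unfolding inj_on_def by (metis atMost_iff linorder_neqE_nat)
  define l where "l = k' - i"
  have il: "i + l = k'" "0 < l" using ik l_def by auto
  have "runs (underlying T) p (wpow w i) (g i)" "runs (underlying T) (g i) (wpow w l) (g i)"
    "runs (underlying T) (g i) (wpow w (?m + k - i)) q"
    using path[of 0 i] path[of i l] path[of i "?m + k - i"] E g ik il by auto
  then show thesis
    using that[of l i _ "g i"] il ik unfolding runs_underlying by blast
qed

end

section \<open>Pumping in an aperiodic transducer\<close>

locale aperiodic_transducer_for = transducer_for T f
  for T :: "('a, 'b) transducer" and f +
  fixes n :: nat
  assumes aper: "\<And>m w. n \<le> m \<Longrightarrow> trans_cong (underlying T) (wpow w m) (wpow w n)"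
begin

lemma truns_wpow_iff:
  assumes "n \<le> m" "n \<le> m'"
  shows "(\<exists>x. truns (ttrans T) p (wpow w m) x q) \<longleftrightarrow> (\<exists>x. truns (ttrans T) p (wpow w m') x q)"
  using aper[OF assms(1), of w] aper[OF assms(2), of w]
  unfolding trans_cong_def runs_underlying by blast

lemma rel_R_wpow:
  assumes "n \<le> m" "n \<le> m'"
  shows "rel_R f (wpow w m @ x) (wpow w m' @ x)"
proof (rule rel_R_if_outruns)
  have "\<exists>r. outrun T q (wpow w m' @ x) r"
    if run: "outrun T q (wpow w m @ x) r" and le: "n \<le> m" "n \<le> m'" for q r m m'
    using run
  proof (rule outrun_appendE)
    fix z q' y assume *: "truns (ttrans T) q (wpow w m) z q'" "outrun T q' x y"
    then obtain z' where "truns (ttrans T) q (wpow w m') z' q'"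
      using truns_wpow_iff[OF le] by blast
    then show ?thesis using outrun_append *(2) by blast
  qed
  then show "(\<exists>r. outrun T q (wpow w m @ x) r) \<longleftrightarrow> (\<exists>r. outrun T q (wpow w m' @ x) r)" for q
    using assms by blast
qed

lemma wpow_in_dom_iff:
  "n \<le> m \<Longrightarrow> n \<le> m' \<Longrightarrow> u @ wpow w m @ x \<in> dom f \<longleftrightarrow> u @ wpow w m' @ x \<in> dom f"
  using rel_R_dom_iff[OF rel_R_wpow] by blast

text \<open>\<open>card (tstates T)\<close> provides a repeated state, the first \<open>n\<close>
  places the exponent where aperiodicity transfers domain membership, and the second
  \<open>n\<close> is an exponent from which on the repeated state has loops on all powers.\<close>

lemma pump_outputs:
  assumes "u @ wpow w (card (tstates T) + n) @ v \<in> dom f"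
  shows "\<exists>A C t. \<forall>j. f (u @ wpow w (card (tstates T) + n + n + j) @ v) = Some (A @ wpow C j @ t)"
proof -
  let ?m = "card (tstates T)"
  obtain p s r where "inrun T u p s" and "outrun T p (wpow w (?m + n) @ v) r"
    using assms unfolding in_dom_iff by blast
  then obtain z q r' where run: "truns (ttrans T) p (wpow w (?m + n)) z q" "outrun T q v r'"
    by (auto elim: outrun_appendE)
  obtain i l p' y z' where l: "0 < l" "i + l \<le> ?m"
    and y: "truns (ttrans T) p (wpow w i) y p'"
    and loop: "\<exists>x. truns (ttrans T) p' (wpow w l) x p'"
    and z': "truns (ttrans T) p' (wpow w (?m + n - i)) z' q"
    using loop_in_wpow[OF inrun_tstates[OF \<open>inrun T u p s\<close>] run(1)] by metis
  define S where "S = s @ y"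
  define R where "R = z' @ r'"
  have S: "inrun T (u @ wpow w i) p' S"
    unfolding S_def using \<open>inrun T u p s\<close> y by (rule inrun_append)
  have R: "outrun T p' (wpow w (?m + n - i) @ v) R"
    unfolding R_def using z' run(2) by (rule outrun_append)
  have "\<exists>x. truns (ttrans T) p' (wpow w (l * k)) x p'" for k
  proof (induction k)
    case (Suc k)
    then show ?case using loop by (auto simp: wpow_add truns_append)
  qed simp
  \<comment> \<open>Since \<open>0 < l\<close>, the exponent \<open>l * n\<close> is at least
    \<open>n\<close>, and aperiodicity carries the loop from there to every \<open>K\<close> from
    \<open>n\<close> on.\<close>
  from this[of n] have "\<exists>x. truns (ttrans T) p' (wpow w K) x p'" if "n \<le> K" for K
    using truns_wpow_iff[of "l * n" K] l(1) that by (cases l) auto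
  then obtain \<alpha> where \<alpha>: "\<And>K. n \<le> K \<Longrightarrow> truns (ttrans T) p' (wpow w K) (\<alpha> K) p'"
    by metis
  have loop2: "truns (ttrans T) p' (wpow w (K + L)) (\<alpha> K @ \<alpha> L) p'" if "n \<le> K" "n \<le> L" for K L
    using \<alpha>[OF that(1)] \<alpha>[OF that(2)] by (auto simp: wpow_add truns_append)
  \<comment> \<open>The loop is inserted at \<open>p'\<close>; the exponents add up as
    \<open>i + K + (?m + n - i)\<close>.\<close>
  have val: "f (u @ wpow w (?m + n + K) @ v) = Some (S @ x @ R)"
    if "truns (ttrans T) p' (wpow w K) x p'" for K x
  proof -
    have "f ((u @ wpow w i) @ (wpow w K @ wpow w (?m + n - i) @ v)) = Some (S @ x @ R)"
      using eqI[OF S outrun_append[OF that R]] by simp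
    moreover have "wpow w i @ wpow w K @ wpow w (?m + n - i) @ v = wpow w (?m + n + K) @ v"
    proof -
      have "?m + n + K = i + (K + (?m + n - i))" using l by simp
      then show ?thesis by (metis append.assoc wpow_add)
    qed
    ultimately show ?thesis by simp
  qed
  \<comment> \<open>Two loops whose exponents have the same sum give the same input, hence the same
    value of \<open>f\<close>; \<open>S\<close> and \<open>R\<close> cancel.\<close>
  have "\<exists>\<gamma>. \<forall>j. \<alpha> (n + j) = \<alpha> n @ wpow \<gamma> j"
  proof (rule additive_outputs)
    fix K L K' L' assume *: "n \<le> K" "n \<le> L" "n \<le> K'" "n \<le> L'" "K + L = K' + L'"
    show "\<alpha> K @ \<alpha> L = \<alpha> K' @ \<alpha> L'"
      using val[OF loop2[OF *(1,2)]] val[OF loop2[OF *(3,4)]] *(5) by simp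
  qed
  then obtain \<gamma> where \<gamma>: "\<And>j. \<alpha> (n + j) = \<alpha> n @ wpow \<gamma> j" by blast
  have "f (u @ wpow w (?m + n + n + j) @ v) = Some ((S @ \<alpha> n) @ wpow \<gamma> j @ R)" for j
    using val[OF \<alpha>[of "n + j"]] \<gamma>[of j] by (simp add: add.assoc)
  then show ?thesis by blast
qed

text \<open>\<open>N\<close> is fixed by the transducer and \<open>n\<close> alone, so it is one
  index for all \<open>u\<close> and \<open>w\<close>.\<close>

lemma rel_L_wpow:
  defines "N \<equiv> card (tstates T) + n + n"
  shows "rel_L f (u @ wpow w N) (u @ wpow w (Suc N))"
  unfolding rel_L_def append.assoc
proof (intro allI conjI impI)
  fix x
  have dom: "u @ wpow w (N + j) @ v \<in> dom f \<longleftrightarrow> u @ wpow w N @ v \<in> dom f" for j v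
    by (rule wpow_in_dom_iff) (auto simp: N_def)
  show "u @ wpow w N @ x \<in> dom f \<longleftrightarrow> u @ wpow w (Suc N) @ x \<in> dom f"
    using dom[of 1 x] by simp
  assume x: "u @ wpow w N @ x \<in> dom f"
  \<comment> \<open>\<open>I\<close> indexes the outputs whose lcp is \<open>fhat\<close>; by
    \<open>dom\<close> it is the same set for all exponents \<open>N + j\<close>.\<close>
  define I where "I = {v. rel_R f v x \<and> u @ wpow w N @ v \<in> dom f}"
  have "\<exists>A C t. \<forall>j. f (u @ wpow w (N + j) @ v) = Some (A @ wpow C j @ t)" if "v \<in> I" for v
  proof -
    have "u @ wpow w (card (tstates T) + n) @ v \<in> dom f"
      using that wpow_in_dom_iff[of "card (tstates T) + n" N] by (auto simp: I_def N_def)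
    then show ?thesis unfolding N_def by (rule pump_outputs)
  qed
  then obtain A C t where
    ACt: "\<And>v j. v \<in> I \<Longrightarrow> f (u @ wpow w (N + j) @ v) = Some (A v @ wpow (C v) j @ t v)"
    by metis
  have "\<exists>P D Z. \<forall>v\<in>I. \<forall>j. A v @ wpow (C v) j @ t v = P @ wpow D j @ Z v"
  proof (rule bounded_wdist_common_form)
    fix v v' assume v: "v \<in> I" "v' \<in> I"
    then have "rel_R f v v'" unfolding I_def using rel_R_sym rel_R_trans by blast
    then obtain K where
      K: "\<And>y. y @ v \<in> dom f \<Longrightarrow> wdist (the (f (y @ v))) (the (f (y @ v'))) \<le> K"
      using rel_R_wdist_bounded by blast
    have "wdist (A v @ wpow (C v) j @ t v) (A v' @ wpow (C v') j @ t v') \<le> K" for j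
      using K[of "u @ wpow w (N + j)"] ACt[OF v(1), of j] ACt[OF v(2), of j] by (simp add: domI)
    then show "\<exists>K. \<forall>j. wdist (A v @ wpow (C v) j @ t v) (A v' @ wpow (C v') j @ t v') \<le> K"
      by blast
  qed
  then obtain P D Z where
    PDZ: "\<And>v j. v \<in> I \<Longrightarrow> A v @ wpow (C v) j @ t v = P @ wpow D j @ Z v" by blast
  have val: "f (u @ wpow w (N + j) @ v) = Some ((P @ wpow D j) @ Z v)" if "v \<in> I" for v j
    using ACt[OF that] PDZ[OF that] by simp
  have xI: "x \<in> I" using x by (simp add: I_def)
  have fhat: "fhat f x (u @ wpow w (N + j)) = (P @ wpow D j) @ lcp_set (Z ` I)" for j
  proof -
    have "{the (f ((u @ wpow w (N + j)) @ v)) |v. rel_R f v x \<and> (u @ wpow w (N + j)) @ v \<in> dom f}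
        = (\<lambda>v. the (f (u @ wpow w (N + j) @ v))) ` I"
      unfolding append.assoc dom by (auto simp: I_def)
    also have "\<dots> = (@) (P @ wpow D j) ` Z ` I"
      unfolding image_image by (rule image_cong[OF refl]) (simp add: val)
    finally show ?thesis
      unfolding fhat_def using xI by (metis empty_iff image_is_empty lcp_set_append)
  qed
  have "lquot (fhat f x (u @ wpow w (N + j))) (the (f (u @ wpow w (N + j) @ x))) =
      lquot (lcp_set (Z ` I)) (Z x)" for j
    unfolding fhat val[OF xI] option.sel by (rule lquot_append)
  from this[of 0] this[of 1]
  show "lquot (fhat f x (u @ wpow w N)) (the (f (u @ wpow w N @ x))) =
      lquot (fhat f x (u @ wpow w (Suc N))) (the (f (u @ wpow w (Suc N) @ x)))"
    by (simp del: wpow_Suc)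
qed

lemma canonical_bimachine_aperiodic: "canonical_bimachine_aperiodic f"
  unfolding canonical_bimachine_aperiodic_def
proof
  let ?N = "card (tstates T) + n + n"
  show "aperiodic_aut (trans_Left f)"
  proof (rule aperiodic_trans_Left)
    \<comment> \<open>\<open>rel_L_wpow\<close> holds at exponent \<open>?N\<close>; one more
      \<open>w\<close> on the right gives the \<open>Suc ?N\<close> of the rule.\<close>
    show "rel_L f (x @ wpow w (Suc ?N)) (x @ wpow w (Suc (Suc ?N)))" for w x
      using rel_L_append[OF rel_L_wpow[of x w], of w]
      unfolding append.assoc wpow_Suc_right[symmetric] .
  qed
  show "aperiodic_aut (trans_R f)"
    by (rule aperiodic_trans_R[of f n], rule rel_R_wpow) auto
qed

end

section \<open>Finiteness of the canonical bimachine\<close>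

lemma finite_uniform_bound:
  fixes P :: "'s \<Rightarrow> nat \<Rightarrow> bool"
  assumes "finite S" and "\<And>s. s \<in> S \<Longrightarrow> \<exists>K. P s K" and "\<And>s K K'. P s K \<Longrightarrow> K \<le> K' \<Longrightarrow> P s K'"
  shows "\<exists>K. \<forall>s\<in>S. P s K"
proof -
  obtain k where k: "\<And>s. s \<in> S \<Longrightarrow> P s (k s)" using assms(2) by metis
  have "k s \<le> sum k S" if "s \<in> S" for s
    using that assms(1) by (intro member_le_sum) auto
  then show ?thesis using k assms(3) by blast
qed

context transducer_for
begin

text \<open>The letters that an \<open>inrun\<close> can emit. The type \<open>'b\<close> may be
  infinite, so delays are counted over this finite alphabet.\<close>

definition output_letters :: "'b set" where
  "output_letters = (\<Union>(p, a, x, q)\<in>ttrans T. set x) \<union> \<Union>(set ` ran (tinit T))"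

lemma finite_output_letters: "finite output_letters"
proof -
  have "finite (ttrans T)" "finite (dom (tinit T))"
    using wf finite_tstates unfolding wf_transducer_def by (blast intro: finite_subset)+
  then show ?thesis unfolding output_letters_def by (auto intro: finite_ran)
qed

lemma truns_output_letters: "truns (ttrans T) p u x q \<Longrightarrow> set x \<subseteq> output_letters"
proof (induction u arbitrary: p x)
  case (Cons a u)
  then obtain y p' z where *: "(p, a, y, p') \<in> ttrans T" "truns (ttrans T) p' u z q" "x = y @ z"
    by auto
  have "set y \<subseteq> output_letters" using *(1) unfolding output_letters_def by fast
  then show ?case using Cons.IH[OF *(2)] *(3) by simp
qed simp

lemma inrun_output_letters:
  assumes "inrun T u q y"
  shows "set y \<subseteq> output_letters"
proof -
  obtain p i x where *: "tinit T p = Some i" "truns (ttrans T) p u x q" "y = i @ x"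
    using assms unfolding inrun_def by blast
  have "set i \<subseteq> output_letters" using *(1) unfolding output_letters_def by (auto intro: ranI)
  then show ?thesis using truns_output_letters[OF *(2)] *(3) by simp
qed

text \<open>One word is picked for each state and right class, so that bounds over the finite
  \<open>V\<close> extend to all words.\<close>

lemma finite_representatives:
  obtains V where "finite V"
    "\<And>q w z. q \<in> tstates T \<Longrightarrow> outrun T q w z \<Longrightarrow> \<exists>v\<in>V. rel_R f v w \<and> (\<exists>r. outrun T q v r)"
proof
  define pick where "pick = (\<lambda>(q, c). SOME v. v \<in> c \<and> (\<exists>r. outrun T q v r))"
  let ?V = "pick ` (tstates T \<times> range (class_R f))"
  show "finite ?V" using finite_tstates finite_class_R by blast
  fix q w z assume q: "q \<in> tstates T" and "outrun T q w z"
  then have "\<exists>v. v \<in> class_R f w \<and> (\<exists>r. outrun T q v r)"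
    unfolding class_R_def using rel_R_refl by blast
  then have "pick (q, class_R f w) \<in> class_R f w \<and> (\<exists>r. outrun T q (pick (q, class_R f w)) r)"
    unfolding pick_def prod.case by (rule someI_ex)
  moreover have "pick (q, class_R f w) \<in> ?V" using q by blast
  ultimately show "\<exists>v\<in>?V. rel_R f v w \<and> (\<exists>r. outrun T q v r)"
    unfolding class_R_def by blast
qed

text \<open>Replacing \<open>w\<close> by a representative in \<open>V\<close> readable from
  \<open>q\<close> gives a value \<open>y @ r\<close> with a short \<open>r\<close>. It has
  \<open>fhat\<close> as a prefix, so \<open>fhat\<close> is not much longer than \<open>y\<close>;
  conversely \<open>y\<close> without its last \<open>K + R\<close> letters is a prefix of all
  outputs in the class.\<close>

lemma bounded_delay:
  obtains N where "\<And>u q y w z. inrun T u q y \<Longrightarrow> outrun T q w z \<Longrightarrow>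
      length (fhat f w u) \<le> length y + N \<and> length y \<le> length (fhat f w u) + N"
proof -
  obtain V where V: "finite V"
    "\<And>q w z. q \<in> tstates T \<Longrightarrow> outrun T q w z \<Longrightarrow> \<exists>v\<in>V. rel_R f v w \<and> (\<exists>r. outrun T q v r)"
    using finite_representatives by blast
  have "\<exists>R. \<forall>s\<in>V \<times> tstates T. (\<exists>r. outrun T (snd s) (fst s) r) \<longrightarrow>
      (\<exists>r. outrun T (snd s) (fst s) r \<and> length r \<le> R)"
    by (rule finite_uniform_bound) (use V(1) finite_tstates in \<open>auto intro: order.trans\<close>)
  then obtain R where "\<forall>s\<in>V \<times> tstates T. (\<exists>r. outrun T (snd s) (fst s) r) \<longrightarrow>
      (\<exists>r. outrun T (snd s) (fst s) r \<and> length r \<le> R)" ..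
  then have R: "\<exists>r. outrun T q v r \<and> length r \<le> R"
    if "v \<in> V" "q \<in> tstates T" "outrun T q v r" for v q r
    using that by fastforce
  have "\<exists>K. \<forall>s\<in>V \<times> V. rel_R f (fst s) (snd s) \<longrightarrow>
    (\<forall>u. u @ fst s \<in> dom f \<longrightarrow> wdist (the (f (u @ fst s))) (the (f (u @ snd s))) \<le> K)"
  proof (rule finite_uniform_bound)
    show "\<exists>K. rel_R f (fst s) (snd s) \<longrightarrow>
      (\<forall>u. u @ fst s \<in> dom f \<longrightarrow> wdist (the (f (u @ fst s))) (the (f (u @ snd s))) \<le> K)" for s
      using rel_R_wdist_bounded[of f "fst s" "snd s"] by blast
  qed (use V(1) in \<open>auto intro: order.trans\<close>)
  then obtain K where "\<forall>s\<in>V \<times> V. rel_R f (fst s) (snd s) \<longrightarrow>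
    (\<forall>u. u @ fst s \<in> dom f \<longrightarrow> wdist (the (f (u @ fst s))) (the (f (u @ snd s))) \<le> K)" ..
  then have K: "wdist (the (f (u @ v))) (the (f (u @ v'))) \<le> K"
    if "v \<in> V" "v' \<in> V" "rel_R f v v'" "u @ v \<in> dom f" for v v' u
    using that by fastforce
  have rep: "\<exists>v r. v \<in> V \<and> rel_R f v w \<and> length r \<le> R \<and> f (u @ v) = Some (y @ r)"
    if run: "inrun T u q y" "outrun T q w z" for u q y w z
    using V(2)[OF inrun_tstates[OF run(1)] run(2)] R[OF _ inrun_tstates[OF run(1)]] eqI[OF run(1)]
    by metis
  show thesis
  proof (rule that[of "K + R"], intro conjI)
    fix u q y w z assume run: "inrun T u q y" "outrun T q w z"
    from rep[OF this] obtain v r where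
      v: "v \<in> V" "rel_R f v w" "length r \<le> R" "f (u @ v) = Some (y @ r)" by blast
    have "prefix (fhat f w u) (y @ r)"
      using prefix_fhat[OF v(2), of u] v(4) by auto
    then show "length (fhat f w u) \<le> length y + (K + R)"
      using v(3) prefix_length_le by fastforce
    \<comment> \<open>\<open>K\<close> letters pay for the distance between two representatives,
      \<open>R\<close> letters for the tail \<open>r'\<close> of the second one.\<close>
    define p where "p = take (length y - (K + R)) y"
    have "prefix p (fhat f w u)"
      unfolding fhat_def
    proof (rule lcp_set_greatest)
      have "u @ w \<in> dom f" using eqI[OF run] by blast
      then show "{the (f (u @ v)) |v. rel_R f v w \<and> u @ v \<in> dom f} \<noteq> {}"
        using rel_R_refl[of f w] by blast
    next
      fix x assume "x \<in> {the (f (u @ v)) |v. rel_R f v w \<and> u @ v \<in> dom f}"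
      then obtain v' where x: "x = the (f (u @ v'))" and v': "rel_R f v' w" "u @ v' \<in> dom f"
        by blast
      then obtain q' y' z' where run': "inrun T u q' y'" "outrun T q' v' z'"
        unfolding in_dom_iff by blast
      from rep[OF this] obtain v'' r' where
        v'': "v'' \<in> V" "rel_R f v'' v'" "length r' \<le> R" "f (u @ v'') = Some (y' @ r')" by blast
      let ?l = "lcp_set {y @ r, y' @ r'}"
      have "rel_R f v v''" using v(2) v'(1) v''(2) rel_R_sym rel_R_trans by blast
      then have "wdist (y @ r) (y' @ r') \<le> K"
        using K[OF v(1) v''(1), of u] v(4) v''(4) by auto
      then have len: "length y \<le> length ?l + K"
        using length_le_wdist[of "y @ r" "y' @ r'"] by simp
      have l: "prefix ?l (y @ r)" "prefix ?l (y' @ r')" by (auto intro: lcp_set_prefix)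
      have "prefix p (y @ r)" unfolding p_def by (simp add: take_is_prefix prefix_prefix)
      then have "prefix p ?l"
        using l(1) len by (rule_tac prefix_length_prefix) (auto simp: p_def)
      then have "prefix p (y' @ r')" using l(2) by (rule prefix_order.trans)
      \<comment> \<open>Only \<open>y'\<close> is known to be shared by \<open>x\<close> and
        \<open>f (u @ v'')\<close>, so \<open>p\<close> has to end before the tail
        \<open>r'\<close>.\<close>
      moreover have "length p \<le> length y'"
        using prefix_length_le[OF l(2)] len v''(3) by (simp add: p_def)
      ultimately have "prefix p y'"
        by (metis prefixI prefix_length_prefix)
      then show "prefix p x" unfolding x eqI[OF run'] by simp
    qed
    then show "length y \<le> length (fhat f w u) + (K + R)"
      using prefix_length_le unfolding p_def by fastforce
  qed
qed

lemma finite_class_L: "finite (range (class_L f))"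
proof -
  obtain N where N: "\<And>u q y w z. inrun T u q y \<Longrightarrow> outrun T q w z \<Longrightarrow>
      length (fhat f w u) \<le> length y + N \<and> length y \<le> length (fhat f w u) + N"
    by (rule bounded_delay) blast
  \<comment> \<open>For each reached state and each right class readable there,
    \<open>\<Phi> u\<close> records the delay of \<open>y\<close> against \<open>fhat\<close>: the
    surplus letters of \<open>y\<close>, or the number of missing ones. By
    \<open>bounded_delay\<close> only finitely many such sets occur.\<close>
  define \<Phi> where "\<Phi> u = {(q, class_R f w, drop (length (fhat f w u)) y, length (fhat f w u) - length y)
      | q w y z. inrun T u q y \<and> outrun T q w z}" for u
  show ?thesis
  proof (rule finite_range_factor)
    let ?X = "tstates T \<times> range (class_R f) \<times> {d. set d \<subseteq> output_letters \<and> length d \<le> N} \<times> {..N}"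
    have "finite ?X"
      using finite_tstates finite_class_R finite_output_letters by (simp add: finite_lists_length_le)
    moreover have "\<Phi> u \<subseteq> ?X" for u
    proof
      fix s assume "s \<in> \<Phi> u"
      then obtain q w y z where s: "inrun T u q y" "outrun T q w z"
        "s = (q, class_R f w, drop (length (fhat f w u)) y, length (fhat f w u) - length y)"
        unfolding \<Phi>_def by blast
      have "set (drop (length (fhat f w u)) y) \<subseteq> output_letters"
        using inrun_output_letters[OF s(1)] set_drop_subset by (rule order.trans[rotated])
      then show "s \<in> ?X"
        using N[OF s(1,2)] inrun_tstates[OF s(1)] by (auto simp: s(3))
    qed
    ultimately show "finite (range \<Phi>)"
      by (meson Pow_iff finite_Pow_iff finite_subset image_subsetI)
  next
    \<comment> \<open>The same tail \<open>z\<close> continues both runs from the common state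
      \<open>q\<close>, and what is left of \<open>y @ z\<close> after deleting \<open>fhat\<close>
      depends only on \<open>z\<close> and the two delay entries.\<close>
    have half: "u' @ w \<in> dom f \<and>
        lquot (fhat f w u) (the (f (u @ w))) = lquot (fhat f w u') (the (f (u' @ w)))"
      if \<Phi>: "\<Phi> u = \<Phi> u'" and dom: "u @ w \<in> dom f" for u u' w
    proof -
      obtain q y z where run: "inrun T u q y" "outrun T q w z"
        using dom unfolding in_dom_iff by blast
      then have "(q, class_R f w, drop (length (fhat f w u)) y, length (fhat f w u) - length y) \<in> \<Phi> u"
        unfolding \<Phi>_def by blast
      then have "(q, class_R f w, drop (length (fhat f w u)) y, length (fhat f w u) - length y) \<in> \<Phi> u'"
        unfolding \<Phi> .
      then obtain w' y' where w': "class_R f w = class_R f w'" and run': "inrun T u' q y'"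
        and eq: "drop (length (fhat f w u)) y = drop (length (fhat f w' u')) y'"
          "length (fhat f w u) - length y = length (fhat f w' u') - length y'"
        unfolding \<Phi>_def by blast
      have "fhat f w' = fhat f w" using w' fhat_cong class_R_eq_iff by metis
      then show ?thesis
        using eq eqI[OF run] eqI[OF run' run(2)] by (simp add: lquot_def domI)
    qed
    fix u u' assume "\<Phi> u = \<Phi> u'"
    then have "rel_L f u u'"
      unfolding rel_L_def using half[of u u'] half[of u' u] by blast
    then show "class_L f u = class_L f u'" by (simp add: class_L_eq_iff)
  qed
qed

end

section \<open>The canonical bimachine as a transducer\<close>

definition rep :: "'c set \<Rightarrow> 'c" where
  "rep c = (SOME x. x \<in> c)"

lemma rel_R_rep: "rel_R f (rep (class_R f w)) w"
proof -
  have "rep (class_R f w) \<in> class_R f w"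
    unfolding rep_def by (rule someI[of _ w]) (simp add: class_R_def)
  then show ?thesis by (simp add: class_R_def)
qed

lemma rel_L_rep: "rel_L f (rep (class_L f u)) u"
proof -
  have "rep (class_L f u) \<in> class_L f u"
    unfolding rep_def by (rule someI[of _ u]) (simp add: class_L_def)
  then show ?thesis by (simp add: class_L_def)
qed

definition omega :: "('a list \<Rightarrow> 'b list option) \<Rightarrow> 'a list set \<Rightarrow> 'a \<Rightarrow> 'a list set \<Rightarrow> 'b list" where
  "omega f l a r = lquot (fhat f (a # rep r) (rep l)) (fhat f (rep r) (rep l @ [a]))"

definition lambda :: "('a list \<Rightarrow> 'b list option) \<Rightarrow> 'a list set \<Rightarrow> 'b list" where
  "lambda f r = fhat f (rep r) []"

definition rho :: "('a list \<Rightarrow> 'b list option) \<Rightarrow> 'a list set \<Rightarrow> 'b list" where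
  "rho f l = lquot (fhat f [] (rep l)) (the (f (rep l)))"

text \<open>The representatives inside \<open>omega\<close> may be exchanged: on the left since
  related words leave the same quotient, on the right since \<open>fhat\<close> depends only on the
  class.\<close>

lemma omega_class:
  "omega f (class_L f u) a (class_R f w) = lquot (fhat f (a # w) u) (fhat f w (u @ [a]))"
proof -
  let ?u = "rep (class_L f u)" and ?w = "rep (class_R f w)"
  have "omega f (class_L f u) a (class_R f w) = lquot (fhat f ([a] @ ?w) ?u) (fhat f ?w (?u @ [a]))"
    by (simp add: omega_def)
  also have "\<dots> = lquot (fhat f ([a] @ ?w) u) (fhat f ?w (u @ [a]))"
    by (rule rel_L_lquot_fhat[OF rel_L_rep])
  also have "\<dots> = lquot (fhat f ([a] @ w) u) (fhat f w (u @ [a]))"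
    using fhat_cong[OF rel_R_rep] fhat_cong[OF rel_R_append[OF rel_R_rep]] by metis
  finally show ?thesis by simp
qed

lemma lambda_class: "lambda f (class_R f w) = fhat f w []"
  by (simp add: lambda_def fhat_cong[OF rel_R_rep])

lemma rho_class:
  assumes "u \<in> dom f"
  shows "rho f (class_L f u) = lquot (fhat f [] u) (the (f u))"
  using rel_L_lquot[OF rel_L_sym[OF rel_L_rep[of f u]], of "[]"] assms by (simp add: rho_def)

text \<open>Transducer states are natural numbers, so pairs of classes are coded by
  \<open>enc\<close>; the finite input type keeps the set of transitions finite.\<close>

locale bimachine_encoding =
  fixes f :: "'a::finite list \<Rightarrow> 'b list option"
    and enc :: "'a list set \<times> 'a list set \<Rightarrow> nat"
  assumes finite_L: "finite (range (class_L f))" and finite_R: "finite (range (class_R f))"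
    and inj_enc: "inj_on enc (range (class_L f) \<times> range (class_R f))"
begin

definition dec :: "nat \<Rightarrow> 'a list set \<times> 'a list set" where
  "dec = inv_into (range (class_L f) \<times> range (class_R f)) enc"

text \<open>A run guesses the right class of the unread input and checks it letter by letter; ending
  in the class of \<open>[]\<close> confirms the guess.\<close>

definition product_transducer :: "('a, 'b) transducer" where
  "product_transducer = \<lparr>
     tstates = enc ` (range (class_L f) \<times> range (class_R f)),
     ttrans = {(enc (l, r), a, omega f l a r', enc (l', r')) | l r a l' r'.
       (l, a, l') \<in> trans_Left f \<and> (r, a, r') \<in> trans_R f},
     tinit = (\<lambda>p. if p \<in> enc ` ({class_L f []} \<times> range (class_R f))
       then Some (lambda f (snd (dec p))) else None),
     tfinal = (\<lambda>p. if p \<in> enc ` (class_L f ` dom f \<times> {class_R f []})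
       then Some (rho f (fst (dec p))) else None)\<rparr>"

lemma dec_enc [simp]: "dec (enc (class_L f u, class_R f w)) = (class_L f u, class_R f w)"
  unfolding dec_def by (rule inv_into_f_f[OF inj_enc]) blast

lemma enc_eq_iff [simp]:
  "enc (class_L f u, class_R f w) = enc (class_L f u', class_R f w') \<longleftrightarrow>
     class_L f u = class_L f u' \<and> class_R f w = class_R f w'"
  by (metis dec_enc prod.inject)

lemma ttrans_product_transducer:
  "(p, a, x, q) \<in> ttrans product_transducer \<longleftrightarrow>
     (\<exists>u w. p = enc (class_L f u, class_R f (a # w)) \<and> q = enc (class_L f (u @ [a]), class_R f w) \<and>
        x = lquot (fhat f (a # w) u) (fhat f w (u @ [a])))"
  unfolding product_transducer_def by (simp add: mem_trans_Left mem_trans_R) (metis omega_class)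

lemma wf_product_transducer: "wf_transducer product_transducer"
proof -
  let ?L = "range (class_L f)" and ?R = "range (class_R f)"
  have "ttrans product_transducer \<subseteq> (\<lambda>(l, r, a, l', r'). (enc (l, r), a, omega f l a r', enc (l', r'))) `
      (?L \<times> ?R \<times> UNIV \<times> ?L \<times> ?R)"
  proof
    fix s assume "s \<in> ttrans product_transducer"
    then obtain l r a l' r' where s: "s = (enc (l, r), a, omega f l a r', enc (l', r'))"
      "(l, a, l') \<in> trans_Left f" "(r, a, r') \<in> trans_R f"
      unfolding product_transducer_def by auto
    then have "(l, r, a, l', r') \<in> ?L \<times> ?R \<times> UNIV \<times> ?L \<times> ?R"
      by (auto simp: mem_trans_Left mem_trans_R)
    then show "s \<in> (\<lambda>(l, r, a, l', r'). (enc (l, r), a, omega f l a r', enc (l', r'))) `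
      (?L \<times> ?R \<times> UNIV \<times> ?L \<times> ?R)"
      by (rule rev_image_eqI) (simp add: s(1))
  qed
  then have "finite (ttrans product_transducer)"
    using finite_L finite_R by (rule_tac finite_subset) auto
  moreover have "ttrans product_transducer \<subseteq>
      tstates product_transducer \<times> UNIV \<times> UNIV \<times> tstates product_transducer"
  proof
    fix s assume s: "s \<in> ttrans product_transducer"
    obtain p a x q where eq: "s = (p, a, x, q)" by (cases s) auto
    show "s \<in> tstates product_transducer \<times> UNIV \<times> UNIV \<times> tstates product_transducer"
      using s unfolding eq ttrans_product_transducer by (auto simp: product_transducer_def)
  qed
  moreover have "dom (tinit product_transducer) \<subseteq> tstates product_transducer"
    "dom (tfinal product_transducer) \<subseteq> tstates product_transducer"
    by (auto simp: product_transducer_def split: if_splits)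
  moreover have "finite (tstates product_transducer)"
    using finite_L finite_R by (simp add: product_transducer_def)
  ultimately show ?thesis unfolding wf_transducer_def by blast
qed

text \<open>Each transition output is the quotient of two successive \<open>fhat\<close> values, so
  the outputs telescope. The domain condition ensures that the divisors are prefixes.\<close>

lemma truns_product_transducer:
  "truns (ttrans product_transducer) (enc (class_L f x, class_R f y)) u z (enc (class_L f x', class_R f w)) \<Longrightarrow>
     class_R f y = class_R f (u @ w) \<and> class_L f x' = class_L f (x @ u) \<and>
     (x @ u @ w \<in> dom f \<longrightarrow> fhat f w (x @ u) = fhat f (u @ w) x @ z)"
proof (induction u arbitrary: x y z)
  case (Cons a u)
  then obtain s z' p where s: "(enc (class_L f x, class_R f y), a, s, p) \<in> ttrans product_transducer"
    "truns (ttrans product_transducer) p u z' (enc (class_L f x', class_R f w))" "z = s @ z'"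
    by auto
  from s(1) obtain x1 y1 where 1: "class_L f x = class_L f x1" "class_R f y = class_R f (a # y1)"
    "p = enc (class_L f (x1 @ [a]), class_R f y1)"
    "s = lquot (fhat f (a # y1) x1) (fhat f y1 (x1 @ [a]))"
    unfolding ttrans_product_transducer by auto
  have x1: "class_L f (x1 @ [a]) = class_L f (x @ [a])"
    using 1(1) rel_L_append by (metis class_L_eq_iff)
  have IH: "class_R f y1 = class_R f (u @ w)" "class_L f x' = class_L f (x @ a # u)"
    "x @ a # u @ w \<in> dom f \<Longrightarrow> fhat f w (x @ a # u) = fhat f (u @ w) (x @ [a]) @ z'"
    using Cons.IH[OF s(2)[unfolded 1(3) x1]] by simp_all
  have y1: "class_R f (a # y1) = class_R f (a # u @ w)"
    using rel_R_append[of f y1 "u @ w" "[a]"] IH(1) by (simp add: class_R_eq_iff)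
  \<comment> \<open>\<open>omega_class\<close> replaces the words \<open>x1\<close>,
    \<open>y1\<close> supplied by the transition by \<open>x\<close> and
    \<open>u @ w\<close>.\<close>
  have "s = lquot (fhat f (a # u @ w) x) (fhat f (u @ w) (x @ [a]))"
    using 1(4) 1(1) IH(1) omega_class by metis
  then have "fhat f (u @ w) (x @ [a]) = fhat f (a # u @ w) x @ s" if "x @ a # u @ w \<in> dom f"
    using append_lquot[OF prefix_fhat_fhat[of x "[a]" "u @ w" f]] that by simp
  then show ?case using 1(2) y1 IH s(3) by simp
qed simp

lemma truns_product_transducer_ex:
  "\<exists>z. truns (ttrans product_transducer)
     (enc (class_L f x, class_R f (u @ w))) u z (enc (class_L f (x @ u), class_R f w))"
proof (induction u arbitrary: x)
  case (Cons a u)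
  have "\<exists>s. (enc (class_L f x, class_R f (a # u @ w)), a, s, enc (class_L f (x @ [a]), class_R f (u @ w)))
      \<in> ttrans product_transducer"
    unfolding ttrans_product_transducer by blast
  then show ?case using Cons.IH[of "x @ [a]"] by (simp; blast)
qed simp

lemma tinit_product_transducer:
  "tinit product_transducer p = Some i \<longleftrightarrow>
     (\<exists>w. p = enc (class_L f [], class_R f w) \<and> i = fhat f w [])"
  unfolding product_transducer_def by (auto simp: lambda_class)

lemma tfinal_product_transducer:
  "tfinal product_transducer p = Some e \<longleftrightarrow>
     (\<exists>u\<in>dom f. p = enc (class_L f u, class_R f []) \<and> e = lquot (fhat f [] u) (the (f u)))"
  unfolding product_transducer_def by (auto simp: rho_class domI)

lemma realizes_product_transducer: "realizes product_transducer f"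
  unfolding realizes_def
proof (intro allI iffI)
  fix u v
  have val: "f u = Some (fhat f u [] @ z @ lquot (fhat f [] u) (the (f u)))"
    if "u \<in> dom f" and "truns (ttrans product_transducer) (enc (class_L f [], class_R f u)) u z
        (enc (class_L f u, class_R f []))" for z
  proof -
    have "fhat f [] u = fhat f u [] @ z"
      using truns_product_transducer[OF that(2)] that(1) by simp
    moreover have "fhat f [] u @ lquot (fhat f [] u) (the (f u)) = the (f u)"
      using append_lquot[OF prefix_fhat[OF rel_R_refl, of u "[]" f]] that(1) by simp
    ultimately show ?thesis using that(1) by auto
  qed
  {
    assume v: "f u = Some v"
    then have dom: "u \<in> dom f" by blast
    obtain z where z: "truns (ttrans product_transducer) (enc (class_L f [], class_R f u)) u z
        (enc (class_L f u, class_R f []))"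
      using truns_product_transducer_ex[of "[]" u "[]"] by auto
    have "v = fhat f u [] @ z @ lquot (fhat f [] u) (the (f u))"
      using val[OF dom z] v by simp
    then show "\<exists>p q i x e. tinit product_transducer p = Some i \<and>
        truns (ttrans product_transducer) p u x q \<and> tfinal product_transducer q = Some e \<and> v = i @ x @ e"
      using z dom tinit_product_transducer tfinal_product_transducer by blast
  next
    assume "\<exists>p q i x e. tinit product_transducer p = Some i \<and>
        truns (ttrans product_transducer) p u x q \<and> tfinal product_transducer q = Some e \<and> v = i @ x @ e"
    then obtain w u' z where z: "truns (ttrans product_transducer) (enc (class_L f [], class_R f w)) u z
        (enc (class_L f u', class_R f []))" and u': "u' \<in> dom f"
      and v: "v = fhat f w [] @ z @ lquot (fhat f [] u') (the (f u'))"
      unfolding tinit_product_transducer tfinal_product_transducer by blast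
    \<comment> \<open>Every accepting run has guessed correctly: it starts in the right class of
      \<open>u\<close> and ends in the left class of \<open>u\<close>.\<close>
    from truns_product_transducer[OF z] have cl: "class_R f w = class_R f u" "class_L f u' = class_L f u"
      by simp_all
    then have "rel_L f u' u" by (simp add: class_L_eq_iff)
    then have dom: "u \<in> dom f" and "lquot (fhat f [] u') (the (f u')) = lquot (fhat f [] u) (the (f u))"
      using rel_L_dom_iff[of f u' u "[]"] rel_L_lquot[of f u' u "[]"] u' by simp_all
    moreover have "fhat f w = fhat f u" using cl(1) fhat_cong class_R_eq_iff by metis
    ultimately show "f u = Some v"
      using val[OF dom z[unfolded cl]] v by simp
  }
qed

text \<open>On nonempty words the two components move independently. The empty word is excluded
  since its run also exists at numbers that encode no pair of classes.\<close>

lemma runs_product_transducer: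
  "u \<noteq> [] \<Longrightarrow> runs (underlying product_transducer) p u q \<longleftrightarrow> (\<exists>l r l' r'. p = enc (l, r) \<and>
     q = enc (l', r') \<and> runs (trans_Left f) l u l' \<and> runs (trans_R f) r u r')"
proof
  assume u: "u \<noteq> []" and "runs (underlying product_transducer) p u q"
  then obtain x where run: "truns (ttrans product_transducer) p u x q"
    unfolding runs_underlying by blast
  have "\<exists>x y. p = enc (class_L f x, class_R f y)"
    using run u by (cases u) (auto simp: ttrans_product_transducer)
  moreover have "\<exists>x y. q = enc (class_L f x, class_R f y)"
    using run u
  proof (induction u arbitrary: p x)
    case (Cons a u)
    then show ?case by (cases "u = []") (auto simp: ttrans_product_transducer)
  qed simp
  ultimately obtain x y x' w where eq: "p = enc (class_L f x, class_R f y)" "q = enc (class_L f x', class_R f w)"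
    by blast
  from truns_product_transducer[OF run[unfolded this]]
  have "class_R f y = class_R f (u @ w)" "class_L f x' = class_L f (x @ u)" by blast+
  then show "\<exists>l r l' r'. p = enc (l, r) \<and>
     q = enc (l', r') \<and> runs (trans_Left f) l u l' \<and> runs (trans_R f) r u r'"
    unfolding runs_trans_R[OF u] runs_trans_Left[OF u] eq by blast
next
  assume u: "u \<noteq> []" and "\<exists>l r l' r'. p = enc (l, r) \<and>
     q = enc (l', r') \<and> runs (trans_Left f) l u l' \<and> runs (trans_R f) r u r'"
  then obtain x w where "p = enc (class_L f x, class_R f (u @ w))" "q = enc (class_L f (x @ u), class_R f w)"
    unfolding runs_trans_R[OF u] runs_trans_Left[OF u] by blast
  then show "runs (underlying product_transducer) p u q"
    unfolding runs_underlying using truns_product_transducer_ex by blast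
qed

lemma aperiodic_product_transducer:
  assumes "aperiodic_aut (trans_Left f)" "aperiodic_aut (trans_R f)"
  shows "aperiodic_aut (underlying product_transducer)"
proof -
  obtain n where n: "\<And>m w. n \<le> m \<Longrightarrow> trans_cong (trans_Left f) (wpow w m) (wpow w n)"
    using aperiodic_autE[OF assms(1)] by blast
  obtain n' where n': "\<And>m w. n' \<le> m \<Longrightarrow> trans_cong (trans_R f) (wpow w m) (wpow w n')"
    using aperiodic_autE[OF assms(2)] by blast
  \<comment> \<open>The sum passes both indices, and \<open>Suc\<close> keeps the powers of a
    nonempty \<open>w\<close> nonempty.\<close>
  let ?N = "Suc (n + n')"
  have L: "runs (trans_Left f) l (wpow w ?N) l' \<longleftrightarrow> runs (trans_Left f) l (wpow w (Suc ?N)) l'" for w l l'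
    using n[of ?N w] n[of "Suc ?N" w] unfolding trans_cong_def by (simp del: wpow_Suc)
  have R: "runs (trans_R f) r (wpow w ?N) r' \<longleftrightarrow> runs (trans_R f) r (wpow w (Suc ?N)) r'" for w r r'
    using n'[of ?N w] n'[of "Suc ?N" w] unfolding trans_cong_def by (simp del: wpow_Suc)
  have "trans_cong (underlying product_transducer) (wpow w ?N) (wpow w (Suc ?N))" for w
  proof (cases "w = []")
    case False
    then have ne: "wpow w ?N \<noteq> []" "wpow w (Suc ?N) \<noteq> []" by simp_all
    show ?thesis
      unfolding trans_cong_def runs_product_transducer[OF ne(1)] runs_product_transducer[OF ne(2)] L R
      by blast
  qed (simp add: trans_cong_def)
  then show ?thesis unfolding aperiodic_aut_def aperiodic_cong_def by blast
qed

end

theorem theorem5p4: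
  fixes f :: "'a::finite list \<Rightarrow> 'b list option"
  assumes "rational f"
  shows "Ap_rational f \<longleftrightarrow> canonical_bimachine_aperiodic f"
proof
  assume "Ap_rational f"
  then obtain T where T: "wf_transducer T" "realizes T f" "aperiodic_aut (underlying T)"
    unfolding Ap_rational_def by blast
  obtain n where "\<And>m w. n \<le> m \<Longrightarrow> trans_cong (underlying T) (wpow w m) (wpow w n)"
    using aperiodic_autE[OF T(3)] by blast
  with T interpret aperiodic_transducer_for T f n
    by unfold_locales
  show "canonical_bimachine_aperiodic f" by (rule canonical_bimachine_aperiodic)
next
  assume ap: "canonical_bimachine_aperiodic f"
  \<comment> \<open>Rationality enters here: any transducer for \<open>f\<close>, aperiodic or not,
    makes both sets of classes finite.\<close>
  obtain T where "wf_transducer T" "realizes T f"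
    using assms unfolding rational_def by blast
  then interpret transducer_for T f by unfold_locales
  obtain enc :: "'a list set \<times> 'a list set \<Rightarrow> nat"
    where "inj_on enc (range (class_L f) \<times> range (class_R f))"
    using finite_imp_inj_to_nat_seg[OF finite_cartesian_product[OF finite_class_L finite_class_R]]
    by blast
  then interpret bimachine_encoding f enc
    using finite_class_L finite_class_R by unfold_locales
  show "Ap_rational f"
    using ap wf_product_transducer realizes_product_transducer aperiodic_product_transducer
    unfolding Ap_rational_def canonical_bimachine_aperiodic_def by blast
qed

end
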